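(* Let $c\in(0,1)$. There is a constant $C=C(c)>0$ such that the following holds. For $0<\beta_1<\beta_2$ let $g_{\mathrm{Foot},\beta_1,\beta_2}$ be the football soliton of the context, regarded via the map $\Psi_{\beta_1,\beta_2}$ of the context as a symmetric 2-tensor on an open subset of $\mathbb{R}^2\setminus\{0\}\cong\mathbb{C}^*$, and let $p_{\beta_1,\beta_2}\in S^2$ be the unique point with moment coordinate $\tau=\beta_1$ and angle $\theta=0$. Let $g_{\mathrm{Cyl}}=\frac{dx\otimes dx+dy\otimes dy}{x^2+y^2}$ on $\mathbb{R}^2\setminus\{0\}$. Then, as $\beta_1/\beta_2\to c$ and $\beta_2\to0$, the tensors $\frac{1}{\beta_1^2}g_{\mathrm{Foot},\beta_1,\beta_2}$ converge to $C\,g_{\mathrm{Cyl}}$ in $C^k$ on compact subsets of $\mathbb{R}^2\setminus\{0\}$ for every $k\ge0$, with $\Psi_{\beta_1,\beta_2}(p_{\beta_1,\beta_2})=e^0=1$; in particular $\big(\frac{1}{\beta_1^2}g_{\mathrm{Foot},\beta_1,\beta_2},p_{\beta_1,\beta_2}\big)\to(C g_{\mathrm{Cyl}},1)$ in the pointed sense.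
   Context: Regard $S^2=\mathbb{C}\cup\{\infty\}$ as the Riemann sphere with $N=\{z=0\}$ and $S=\{z=\infty\}$, and write $z=|z|e^{i\theta}$. For $0<\beta_1<\beta_2$, the football soliton $g_{\mathrm{Foot},\beta_1,\beta_2}$ is the unique Riemannian metric on $S^2\setminus\{N,S\}$, compatible with the complex structure, with a conical singularity of angle $2\pi\beta_1$ at $N$ and of angle $2\pi\beta_2$ at $S$, of total area $2\pi(\beta_1+\beta_2)$, which is a gradient Ricci soliton in the sense that its Kähler form $\omega$ satisfies $\mathrm{Ric}\,\omega=\omega-\mathcal{L}_X\omega+2\pi(1-\beta_1)\delta_N+2\pi(1-\beta_2)\delta_S$ for a gradient vector field $X$. The metric is rotationally symmetric, so on $\mathbb{C}^*$ one has $\omega=\sqrt{-1}\partial\bar\partial f(s)$ with $s=\log|z|^2$ and $f$ strictly convex; the moment coordinate is $\tau=f'(s)$, normalized (by adding a linear function of $s$ to $f$) so that $\tau\to0$ at $N$; then $\tau$ takes values in $(0,\beta_1+\beta_2)$. Let $a=a(\beta_1,\beta_2)$ be the unique number in $(0,1/\beta_1)$ with $a\beta_1-1+(a\beta_2+1)e^{-a(\beta_1+\beta_2)}=0$. Let $b=b(c)$ be the unique positive solution $x\in(0,1/c)$ of $cx-1+(x+1)e^{-x(1+c)}=0$, and $B=B(c)=1-(1+b)e^{-b}>0$. The map $\Psi_{\beta_1,\beta_2}:S^2\setminus\{N,S\}\to\mathbb{C}^*\cong\mathbb{R}^2\setminus\{0\}$ sends the point with moment coordinate $\tau$ and angle $\theta$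 to $\exp\big(a^2(\beta_1-\tau)/(2B)+i\theta\big)$; tensors are transported via this map. *)

theory Defs
  imports "HOL-Analysis.Analysis"
begin

text \<open>Football soliton, described through its rotationally symmetric Kaehler potential
  f(s), s = log |z|^2, on C* (omega = i dd-bar f(s)). The associated Riemannian metric is
  g = 2 f''(s) |dz|^2 / |z|^2 (convention g(u,v) = omega(u, J v)).
  Conditions:
   - f smooth, strictly convex;
   - moment coordinate tau = f'(s) tends to 0 at N (s -> -infinity) and to
     beta1+beta2 at S (s -> +infinity); the total area is 2 pi (beta1+beta2);
   - conical angle 2 pi beta1 at N, 2 pi beta2 at S: (log f'')' tends to beta1 resp. -beta2;
   - gradient Kaehler-Ricci soliton equation Ric omega = omega - L_X omega on C*, with
     X = lam * r d/dr the S^1-invariant holomorphic gradient field; with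
     omega = f'' ds/\dtheta and Ric omega = -(log f'')'' ds/\dtheta this reads
     -(log f'')'' = f'' - 2 lam f'''.\<close>

definition football_pot :: "real \<Rightarrow> real \<Rightarrow> (real \<Rightarrow> real) \<Rightarrow> bool" where
  "football_pot b1 b2 f \<longleftrightarrow>
     (\<forall>k s. ((deriv ^^ k) f) differentiable (at s)) \<and>
     (\<forall>s. (deriv ^^ 2) f s > 0) \<and>
     ((deriv f) \<longlongrightarrow> 0) at_bot \<and>
     ((deriv f) \<longlongrightarrow> b1 + b2) at_top \<and>
     ((\<lambda>s. (deriv ^^ 3) f s / (deriv ^^ 2) f s) \<longlongrightarrow> b1) at_bot \<and>
     ((\<lambda>s. (deriv ^^ 3) f s / (deriv ^^ 2) f s) \<longlongrightarrow> - b2) at_top \<and>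
     (\<exists>lam. \<forall>s. - deriv (deriv (\<lambda>t. ln ((deriv ^^ 2) f t))) s
                  = (deriv ^^ 2) f s - 2 * lam * (deriv ^^ 3) f s)"

text \<open>A chosen potential (unique up to the translation s -> s + const, i.e. z -> mu z;
  all quantities below are invariant under this).\<close>
definition foot_pot :: "real \<Rightarrow> real \<Rightarrow> real \<Rightarrow> real" where
  "foot_pot b1 b2 = (SOME f. football_pot b1 b2 f)"

definition a_par :: "real \<Rightarrow> real \<Rightarrow> real" where
  "a_par b1 b2 = (THE a. 0 < a \<and> a < 1 / b1 \<and>
      a * b1 - 1 + (a * b2 + 1) * exp (- a * (b1 + b2)) = 0)"

definition b_par :: "real \<Rightarrow> real" where
  "b_par c = (THE x. 0 < x \<and> x < 1 / c \<and> c * x - 1 + (x + 1) * exp (- x * (1 + c)) = 0)"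

definition B_par :: "real \<Rightarrow> real" where
  "B_par c = 1 - (1 + b_par c) * exp (- b_par c)"

text \<open>The map Psi (in the coordinate z of C* = S^2 minus {N,S}): the point z has moment
  coordinate tau = f'(log |z|^2) and angle theta = arg z.\<close>
definition Psi :: "real \<Rightarrow> real \<Rightarrow> real \<Rightarrow> complex \<Rightarrow> complex" where
  "Psi c b1 b2 z =
     (let tau = deriv (foot_pot b1 b2) (ln ((cmod z)\<^sup>2)); a = a_par b1 b2
      in complex_of_real (exp (a\<^sup>2 * (b1 - tau) / (2 * B_par c))) * (z / complex_of_real (cmod z)))"

definition basis2 :: "nat \<Rightarrow> complex" where
  "basis2 i = (if i = 0 then 1 else \<i>)"

text \<open>Components (w.r.t. d/dx, d/dy, identifying R^2 with C) of the football metric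
  g = 2 f''(log|z|^2) |dz|^2/|z|^2 transported to the image of Psi: the push-forward
  (Psi^-1)^* g.\<close>
definition foot_tensor :: "real \<Rightarrow> real \<Rightarrow> real \<Rightarrow> nat \<Rightarrow> nat \<Rightarrow> complex \<Rightarrow> real" where
  "foot_tensor c b1 b2 i j w =
     (let z = inv_into (- {0}) (Psi c b1 b2) w;
          L = inv (frechet_derivative (Psi c b1 b2) (at z))
      in 2 * (deriv ^^ 2) (foot_pot b1 b2) (ln ((cmod z)\<^sup>2)) / (cmod z)\<^sup>2
           * inner (L (basis2 i)) (L (basis2 j)))"

definition cyl_tensor :: "nat \<Rightarrow> nat \<Rightarrow> complex \<Rightarrow> real" where
  "cyl_tensor i j w = (if i = j then 1 / (cmod w)\<^sup>2 else 0)"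

fun dpart :: "nat list \<Rightarrow> (complex \<Rightarrow> real) \<Rightarrow> complex \<Rightarrow> real" where
  "dpart [] g = g"
| "dpart (d # ds) g = (\<lambda>w. deriv (\<lambda>t. dpart ds g (w + complex_of_real t * basis2 d)) 0)"

end

theory Submission
  imports Defs
begin

text \<open>In the moment coordinate \<open>\<tau> = f'(s)\<close> the soliton equation integrates to
  \<open>f'' = F(\<tau>) = (a \<tau> + (1 - a b1) (1 - e\<^sup>a\<^sup>\<tau>)) / a\<^sup>2\<close>; the condition \<open>F(b1 + b2) = 0\<close> is the equation
  for \<open>a\<close>. With \<open>w = e\<^sup>\<rho>\<^sup>+\<^sup>i\<^sup>\<theta>\<close>, \<open>\<rho> = \<kappa> (b1 - \<tau>)\<close> and \<open>\<kappa> = a\<^sup>2 / (2 B)\<close>, the metric is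
  \<open>d\<rho>\<^sup>2 / (2 \<kappa>\<^sup>2 F) + 2 F d\<theta>\<^sup>2\<close>. By scaling \<open>a b2 = b(b1 / b2)\<close>, so that \<open>a b1\<close> tends to \<open>\<alpha> = c b(c)\<close>
  and \<open>1 / a\<close> tends to 0. On compact sets \<open>a \<tau>\<close> then tends to \<open>\<alpha>\<close> and \<open>a\<^sup>2 F\<close> tends to \<open>B\<close>, so that after
  division by \<open>b1\<^sup>2\<close> both coefficients tend to \<open>C = 2 B / \<alpha>\<^sup>2\<close>.\<close>

section \<open>The equation for a\<close>

text \<open>The potential is an arbitrary choice and its soliton constant \<open>lam\<close> is only
  existentially quantified, so nothing can be read off from an explicit f. Hence two facts are
  needed: some potential exists, and every potential has the same profile F, because the conditions
  at the poles force 2 lam = a. After that everything depends on \<open>\<tau>\<close> alone, and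
  the freedom to translate s disappears. The factor 1 / (2 B) in \<open>\<kappa>\<close> balances
  the two directions: with any other positive factor the coefficients of d\<rho>^2 and d\<theta>^2
  would have different limits.\<close>

definition par_fun :: "real \<Rightarrow> real \<Rightarrow> real \<Rightarrow> real" where
  "par_fun b1 b2 x = x * b1 - 1 + (x * b2 + 1) * exp (- x * (b1 + b2))"

text \<open>On \<open>- 1 / b2 < x < 1 / b1\<close> the functions \<open>par_fun\<close> and \<open>par_log\<close> have the same sign, but only
  \<open>par_log\<close> has a derivative whose sign is that of a product of linear factors.\<close>
definition par_log :: "real \<Rightarrow> real \<Rightarrow> real \<Rightarrow> real" where
  "par_log b1 b2 x = ln (1 + b2 * x) - ln (1 - b1 * x) - (b1 + b2) * x"

text \<open>\<open>par_fun\<close> is a difference of two exponentials whose exponents differ by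
  \<open>par_log\<close>, and exp is increasing.\<close>

lemma par_fun_sgn:
  assumes "1 + b2 * x > 0" "1 - b1 * x > 0"
  shows "par_fun b1 b2 x < 0 \<longleftrightarrow> par_log b1 b2 x < 0"
    and "par_fun b1 b2 x > 0 \<longleftrightarrow> par_log b1 b2 x > 0"
proof -
  have e: "(x * b2 + 1) * exp (- x * (b1 + b2)) = exp (ln (1 + b2 * x) - (b1 + b2) * x)"
    using assms by (simp add: exp_diff exp_minus field_simps flip: exp_add)
  have e': "1 - x * b1 = exp (ln (1 - b1 * x))"
    using assms by (simp add: mult.commute)
  have d: "par_fun b1 b2 x = exp (ln (1 + b2 * x) - (b1 + b2) * x) - exp (ln (1 - b1 * x))"
    unfolding par_fun_def e e'[symmetric] by simp
  show "par_fun b1 b2 x < 0 \<longleftrightarrow> par_log b1 b2 x < 0"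
    unfolding d par_log_def diff_less_0_iff_less exp_less_cancel_iff by linarith
  show "par_fun b1 b2 x > 0 \<longleftrightarrow> par_log b1 b2 x > 0"
    unfolding d par_log_def diff_gt_0_iff_gt exp_less_cancel_iff by linarith
qed

lemma par_log_deriv:
  assumes "1 + b2 * x > 0" "1 - b1 * x > 0"
  shows "(par_log b1 b2 has_real_derivative
           (b1 + b2) * x * (b1 * b2 * x - (b2 - b1)) / ((1 + b2 * x) * (1 - b1 * x))) (at x)"
proof -
  have "(par_log b1 b2 has_real_derivative
          (b2 / (1 + b2 * x) + b1 / (1 - b1 * x) - (b1 + b2))) (at x)"
    unfolding par_log_def
    by (rule derivative_eq_intros refl | use assms in simp)+
  moreover have "b2 / (1 + b2 * x) + b1 / (1 - b1 * x) - (b1 + b2)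
     = (b1 + b2) * x * (b1 * b2 * x - (b2 - b1)) / ((1 + b2 * x) * (1 - b1 * x))"
    using assms by (simp add: divide_simps) (simp add: algebra_simps)
  ultimately show ?thesis by simp
qed

text \<open>\<open>par_log\<close> vanishes at 0, increases before 0, decreases on
  [0, \<open>x1\<close>] and increases after \<open>x1\<close>, so its only other zero lies beyond
  \<open>x1\<close>. Outside (- 1 / b2, 1 / b1) the logarithms carry no information, and there the
  signs of the two summands of \<open>par_fun\<close> decide.\<close>

lemma par_fun_root:
  assumes "0 < b1" "b1 < b2"
  obtains a where "0 < a" "a < 1 / b1" "par_fun b1 b2 a = 0"
    "\<And>x. x < 0 \<Longrightarrow> par_fun b1 b2 x < 0"
    "\<And>x. 0 < x \<Longrightarrow> x < a \<Longrightarrow> par_fun b1 b2 x < 0"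
    "\<And>x. a < x \<Longrightarrow> par_fun b1 b2 x > 0"
proof -
  \<comment> \<open>The critical point of \<open>par_log\<close> other than 0; it is positive
    because b1 < b2.\<close>
  define x1 where "x1 = (b2 - b1) / (b1 * b2)"
  have b2: "0 < b2" using assms by simp
  have x1: "0 < x1" "x1 < 1 / b1" using assms b2 by (auto simp: x1_def field_simps)
  have dom: "1 + b2 * x > 0" "1 - b1 * x > 0" if "- 1 / b2 < x" "x < 1 / b1" for x
    using that assms b2 by (auto simp: field_simps)
  have zero: "par_log b1 b2 0 = 0" by (simp add: par_log_def)
  have x1m: "b1 * b2 * x - (b2 - b1) = b1 * b2 * (x - x1)" for x
    using assms b2 by (simp add: x1_def field_simps)
  have dpos: "\<exists>y. (par_log b1 b2 has_real_derivative y) (at x) \<and> y > 0"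
    if "- 1 / b2 < x" "x < 1 / b1" "x * (x - x1) > 0" for x
  proof -
    have "(b1 + b2) * x * (b1 * b2 * x - (b2 - b1)) = (b1 + b2) * (b1 * b2) * (x * (x - x1))"
      unfolding x1m by (simp add: algebra_simps)
    also have "\<dots> > 0" using that assms b2 by simp
    finally show ?thesis
      using par_log_deriv[OF dom[OF that(1,2)]] dom[OF that(1,2)]
      by (metis divide_pos_pos mult_pos_pos)
  qed
  have dneg: "\<exists>y. (par_log b1 b2 has_real_derivative y) (at x) \<and> y < 0"
    if "- 1 / b2 < x" "x < 1 / b1" "x * (x - x1) < 0" for x
  proof -
    have "(b1 + b2) * x * (b1 * b2 * x - (b2 - b1)) = (b1 + b2) * (b1 * b2) * (x * (x - x1))"
      unfolding x1m by (simp add: algebra_simps)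
    also have "\<dots> < 0" using that assms b2 by (simp add: mult_pos_neg)
    finally show ?thesis
      using par_log_deriv[OF dom[OF that(1,2)]] dom[OF that(1,2)]
      by (metis divide_neg_pos mult_pos_pos)
  qed
  have cont: "continuous_on S (par_log b1 b2)" if "S \<subseteq> {- 1 / b2<..<1 / b1}" for S
    using that par_log_deriv[OF dom] 
    by (intro continuous_at_imp_continuous_on ballI) (force intro: DERIV_isCont)
  have m1: "- (1 / b2) < x" if "x \<ge> 0" for x
  proof -
    have "1 / b2 > 0" using b2 by simp
    with that show ?thesis by linarith
  qed
  have neg: "par_log b1 b2 x < 0" if "- 1 / b2 < x" "x < 0" for x
  proof -
    have "par_log b1 b2 x < par_log b1 b2 0"
      by (rule DERIV_pos_imp_increasing_open[OF that(2)])
        (use that x1 in \<open>auto intro!: dpos cont mult_neg_neg\<close>)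
    then show ?thesis using zero by simp
  qed
  have mid: "par_log b1 b2 x < 0" if "0 < x" "x \<le> x1" for x
  proof -
    have "par_log b1 b2 0 > par_log b1 b2 x"
      by (rule DERIV_neg_imp_decreasing_open[OF that(1)])
        (use that x1 m1 in \<open>auto intro!: dneg cont mult_pos_neg simp: m1\<close>)
    then show ?thesis using zero by simp
  qed
  have inc: "par_log b1 b2 x < par_log b1 b2 y" if "x1 \<le> x" "x < y" "y < 1 / b1" for x y
    by (rule DERIV_pos_imp_increasing_open[OF that(2)])
      (use that x1 m1 in \<open>auto intro!: dpos cont mult_pos_pos simp: m1\<close>)
  have h1: "par_fun b1 b2 x1 < 0"
    using par_fun_sgn(1)[OF dom] x1 m1 mid[of x1] by simp
  have big: "par_fun b1 b2 x > 0" if "x \<ge> 1 / b1" for x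
  proof -
    have "1 / b1 > 0" using assms by simp
    then have "x > 0" using that by linarith
    moreover have "x * b1 \<ge> 1" using that assms by (simp add: field_simps)
    ultimately have x: "x * b1 \<ge> 1" "x > 0" by auto
    have "(x * b2 + 1) * exp (- x * (b1 + b2)) > 0"
      using x b2 by (simp add: add_pos_pos)
    then show ?thesis using x by (simp add: par_fun_def)
  qed
  \<comment> \<open>The intermediate value theorem is applied to \<open>par_fun\<close>, which is
    continuous up to 1 / b1, where \<open>par_log\<close> is singular.\<close>
  have "\<exists>a\<ge>x1. a \<le> 1 / b1 \<and> par_fun b1 b2 a = 0"
    by (rule IVT') (use h1 big[of "1/b1"] x1 in \<open>auto simp: par_fun_def intro!: continuous_intros\<close>)
  then obtain a where a: "x1 \<le> a" "a \<le> 1 / b1" "par_fun b1 b2 a = 0" by blast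
  have a2: "a < 1 / b1" using a big[of a] by force
  have la: "par_log b1 b2 a = 0"
    using par_fun_sgn[OF dom, of a] a a2 x1 m1 by force
  have ax1: "x1 < a" using a h1 by (cases "x1 = a") auto
  show thesis
  proof (rule that[of a])
    fix x :: real assume x: "x < 0"
    show "par_fun b1 b2 x < 0"
    proof (cases "- 1 / b2 < x")
      case True
      then show ?thesis using neg[OF True x] par_fun_sgn(1)[OF dom, of x] x x1 by simp
    next
      case False
      then have "x * b2 + 1 \<le> 0" using b2 by (simp add: field_simps)
      then have "(x * b2 + 1) * exp (- x * (b1 + b2)) \<le> 0" by (simp add: mult_le_0_iff)
      moreover have "x * b1 < 0" using x assms by (simp add: mult_neg_pos)
      ultimately show ?thesis by (simp add: par_fun_def)
    qed
  next
    fix x assume x: "0 < x" "x < a"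
    have "par_log b1 b2 x < 0"
    proof (cases "x \<le> x1")
      case False
      then show ?thesis using inc[of x a] x a2 la by simp
    qed (use mid x in auto)
    then show "par_fun b1 b2 x < 0" using par_fun_sgn(1)[OF dom, of x] x a2 m1 by simp
  next
    fix x assume x: "a < x"
    show "par_fun b1 b2 x > 0"
    proof (cases "x < 1 / b1")
      case True
      then show ?thesis using inc[of a x] x la par_fun_sgn(2)[OF dom, of x] a x1 m1 by simp
    qed (use big in auto)
  qed (use a2 a ax1 x1 in auto)
qed

lemma a_par_unfold: "a_par b1 b2 = (THE a. 0 < a \<and> a < 1 / b1 \<and> par_fun b1 b2 a = 0)"
  by (simp add: a_par_def par_fun_def)

lemma a_par_props:
  assumes "0 < b1" "b1 < b2"
  shows "0 < a_par b1 b2" "a_par b1 b2 < 1 / b1" "par_fun b1 b2 (a_par b1 b2) = 0"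
    "x < 0 \<Longrightarrow> par_fun b1 b2 x < 0"
    "0 < x \<Longrightarrow> x < a_par b1 b2 \<Longrightarrow> par_fun b1 b2 x < 0"
    "a_par b1 b2 < x \<Longrightarrow> par_fun b1 b2 x > 0"
proof -
  obtain a where a: "0 < a" "a < 1 / b1" "par_fun b1 b2 a = 0"
    "\<And>x. x < 0 \<Longrightarrow> par_fun b1 b2 x < 0"
    "\<And>x. 0 < x \<Longrightarrow> x < a \<Longrightarrow> par_fun b1 b2 x < 0"
    "\<And>x. a < x \<Longrightarrow> par_fun b1 b2 x > 0"
    using par_fun_root[OF assms] by blast
  have "a_par b1 b2 = a"
    unfolding a_par_unfold
  proof (rule the_equality)
    fix y assume "0 < y \<and> y < 1 / b1 \<and> par_fun b1 b2 y = 0"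
    then show "y = a" using a(5)[of y] a(6)[of y] by (cases y a rule: linorder_cases) auto
  qed (use a in auto)
  then show "0 < a_par b1 b2" "a_par b1 b2 < 1 / b1" "par_fun b1 b2 (a_par b1 b2) = 0"
    "x < 0 \<Longrightarrow> par_fun b1 b2 x < 0"
    "0 < x \<Longrightarrow> x < a_par b1 b2 \<Longrightarrow> par_fun b1 b2 x < 0"
    "a_par b1 b2 < x \<Longrightarrow> par_fun b1 b2 x > 0"
    using a by auto
qed

text \<open>No sign of \<open>x\<close> is assumed, so the soliton constant of an unknown potential
  can be identified as soon as it is known to be nonzero.\<close>

lemma a_par_eqI:
  assumes "0 < b1" "b1 < b2" "x \<noteq> 0" "par_fun b1 b2 x = 0"
  shows "x = a_par b1 b2"
  using a_par_props(4-6)[OF assms(1,2), of x] assms(3,4)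
  by (cases "x < 0"; cases "x < a_par b1 b2"; cases "x > a_par b1 b2") auto

lemma b_par_eq: "b_par c = a_par c 1"
  by (simp add: b_par_def a_par_def mult.commute add.commute)

text \<open>The equation involves only the products x b1 and x b2, so dividing both angles by b2
  multiplies the root by b2.\<close>

lemma a_par_scale:
  assumes "0 < b1" "b1 < b2"
  shows "a_par b1 b2 = b_par (b1 / b2) / b2"
proof -
  have c: "0 < b1 / b2" "b1 / b2 < 1" using assms by auto
  define b where "b = b_par (b1 / b2)"
  have b: "b > 0" "par_fun (b1 / b2) 1 b = 0"
    using a_par_props[OF c] by (auto simp: b_def b_par_eq)
  have "b / b2 * (b1 + b2) = b * (b1 / b2 + 1)" using assms by (simp add: field_simps)
  then have "par_fun b1 b2 (b / b2) = par_fun (b1 / b2) 1 b"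
    using assms by (simp add: par_fun_def)
  then show ?thesis using a_par_eqI[OF assms, of "b / b2"] b assms by (simp add: b_def)
qed

text \<open>The sign of \<open>par_fun\<close> at a positive test point tells on which side of the
  root it lies, and this sign persists under small changes of c. So the root is trapped without an
  implicit function theorem.\<close>

lemma isCont_b_par:
  assumes "0 < c" "c < 1"
  shows "isCont b_par c"
proof -
  let ?b = "b_par c"
  have tend: "((\<lambda>c. par_fun c 1 x) \<longlongrightarrow> par_fun c 1 x) (at c)" for x
    unfolding par_fun_def by (intro tendsto_intros)
  have ev: "eventually (\<lambda>d. 0 < d \<and> d < 1) (at c)"
    using order_tendstoD(1)[OF tendsto_ident_at assms(1)] order_tendstoD(2)[OF tendsto_ident_at assms(2)]
    by eventually_elim simp
  have pos: "?b > 0" using a_par_props(1)[OF assms] by (simp add: b_par_eq)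
  show ?thesis unfolding isCont_def
  proof (rule order_tendstoI)
    fix y assume y: "y < ?b"
    \<comment> \<open>The test point must be positive: \<open>par_fun\<close> is negative on the
      negative axis too, so its sign there does not locate the root.\<close>
    define x where "x = (max y 0 + ?b) / 2"
    have x: "0 < x" "x < ?b" "y < x" using y pos by (auto simp: x_def)
    have "par_fun c 1 x < 0" using a_par_props(5)[OF assms, of x] x by (simp add: b_par_eq)
    from order_tendstoD(2)[OF tend this] ev
    show "eventually (\<lambda>d. y < b_par d) (at c)"
    proof eventually_elim
      case (elim d)
      then show ?case using a_par_props(3)[of d 1] a_par_props(6)[of d 1 x] x
        by (cases x "a_par d 1" rule: linorder_cases) (auto simp: b_par_eq)
    qed
  next
    fix x assume x: "?b < x"
    have "par_fun c 1 x > 0" using a_par_props(6)[OF assms, of x] x by (simp add: b_par_eq)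
    from order_tendstoD(1)[OF tend this] ev
    show "eventually (\<lambda>d. b_par d < x) (at c)"
    proof eventually_elim
      case (elim d)
      then show ?case using a_par_props(3)[of d 1] a_par_props(5)[of d 1 x] x pos
        by (cases x "a_par d 1" rule: linorder_cases) (auto simp: b_par_eq)
    qed
  qed
qed

section \<open>The moment profile\<close>

text \<open>With \<open>u = a \<tau>\<close> and \<open>\<alpha> = a b1\<close>, this is \<open>a\<^sup>2\<close> times the moment profile \<open>F\<close> of the football.\<close>
definition mom :: "real \<Rightarrow> real \<Rightarrow> real" where
  "mom \<alpha> u = u + (1 - \<alpha>) * (1 - exp u)"

lemma mom_deriv: "(mom \<alpha> has_real_derivative 1 - (1 - \<alpha>) * exp u) (at u)"
  unfolding mom_def by (auto intro!: derivative_eq_intros)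

lemma mom_0 [simp]: "mom \<alpha> 0 = 0"
  by (simp add: mom_def)

text \<open>Up to a positive factor, the equation for a says that the profile vanishes at the pole
  S.\<close>

lemma mom_par_fun: "mom (b1 * x) (x * (b1 + b2)) = exp (x * (b1 + b2)) * par_fun b1 b2 x"
  unfolding mom_def par_fun_def by (simp add: algebra_simps flip: exp_add)

text \<open>Strict concavity between two zeros. If the value at \<open>u\<close> were not positive,
  the mean value theorem would give a slope at most 0 before \<open>u\<close> and one at least 0
  after it, but the slope is strictly decreasing.\<close>

lemma mom_pos:
  assumes "\<alpha> < 1" "0 < u" "u < M" "mom \<alpha> M = 0"
  shows "mom \<alpha> u > 0"
proof (rule ccontr)
  assume neg: "\<not> ?thesis"
  obtain x where x: "0 < x" "x < u" "mom \<alpha> u - mom \<alpha> 0 = (u - 0) * (1 - (1 - \<alpha>) * exp x)"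
    using MVT2[OF assms(2) mom_deriv] by blast
  obtain y where y: "u < y" "y < M" "mom \<alpha> M - mom \<alpha> u = (M - u) * (1 - (1 - \<alpha>) * exp y)"
    using MVT2[OF assms(3) mom_deriv] by blast
  have "u * (1 - (1 - \<alpha>) * exp x) \<le> 0" using x neg by simp
  then have 1: "1 - (1 - \<alpha>) * exp x \<le> 0" using assms by (simp add: mult_le_0_iff)
  have "(M - u) * (1 - (1 - \<alpha>) * exp y) \<ge> 0" using y neg assms by simp
  then have 2: "1 - (1 - \<alpha>) * exp y \<ge> 0" using assms by (simp add: zero_le_mult_iff)
  have "(1 - \<alpha>) * exp x < (1 - \<alpha>) * exp y" using x y assms by simp
  with 1 2 show False by simp
qed

text \<open>A concave function lies below its tangents. The tangents at the two zeros give linear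
  bounds on the profile at both poles.\<close>

lemma mom_le:
  assumes "\<alpha> < 1" 
  shows "mom \<alpha> u \<le> mom \<alpha> v + (1 - (1 - \<alpha>) * exp v) * (u - v)"
proof -
  have "exp v * (1 + (u - v)) \<le> exp v * exp (u - v)"
    by (intro mult_left_mono) auto
  also have "\<dots> = exp u" by (simp flip: exp_add)
  finally have "(1 - \<alpha>) * (exp v * (1 + (u - v))) \<le> (1 - \<alpha>) * exp u"
    using assms by (intro mult_left_mono) auto
  then show ?thesis by (simp add: mom_def algebra_simps)
qed

definition foot_prof :: "real \<Rightarrow> real \<Rightarrow> real \<Rightarrow> real" where
  "foot_prof b1 b2 \<tau> = mom (a_par b1 b2 * b1) (a_par b1 b2 * \<tau>) / (a_par b1 b2)\<^sup>2"

context
  fixes b1 b2 a :: real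
  assumes b: "0 < b1" "b1 < b2"
  defines "a \<equiv> a_par b1 b2"
begin

lemma a_pos: "a > 0" "a * b1 < 1"
  using a_par_props(1,2)[OF b] b by (auto simp: a_def field_simps)

lemma mom_end: "mom (a * b1) (a * (b1 + b2)) = 0"
  using mom_par_fun[of b1 a b2] a_par_props(3)[OF b] by (simp add: a_def mult.commute)

lemma foot_prof_pos:
  assumes "0 < \<tau>" "\<tau> < b1 + b2"
  shows "foot_prof b1 b2 \<tau> > 0"
  using mom_pos[OF a_pos(2) _ _ mom_end, of "a * \<tau>"] assms a_pos
  by (simp add: foot_prof_def flip: a_def)

text \<open>Along \<open>\<phi>' = F(\<phi>)\<close> this reads
  \<open>\<phi>'' / \<phi>' = a \<phi>' + b1 - \<phi>\<close>, which is the soliton equation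
  integrated once in s.\<close>

lemma foot_prof_deriv:
  "(foot_prof b1 b2 has_real_derivative a * foot_prof b1 b2 \<tau> + b1 - \<tau>) (at \<tau>)"
proof -
  have "((\<lambda>\<tau>. mom (a * b1) (a * \<tau>) / a\<^sup>2) has_real_derivative
      (1 - (1 - a * b1) * exp (a * \<tau>)) * a / a\<^sup>2) (at \<tau>)"
    by (intro DERIV_cdivide DERIV_chain2[OF mom_deriv]) (auto intro!: derivative_eq_intros)
  moreover have "(1 - (1 - a * b1) * exp (a * \<tau>)) * a / a\<^sup>2
      = a * (mom (a * b1) (a * \<tau>) / a\<^sup>2) + b1 - \<tau>"
    using a_pos unfolding mom_def by (simp add: field_simps power2_eq_square)
  ultimately show ?thesis by (simp add: foot_prof_def[abs_def] flip: a_def)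
qed

lemma foot_prof_ends: "foot_prof b1 b2 0 = 0" "foot_prof b1 b2 (b1 + b2) = 0"
  using mom_end by (auto simp: foot_prof_def a_def)

lemma foot_prof_le:
  assumes "\<tau> \<ge> 0"
  shows "foot_prof b1 b2 \<tau> \<le> b1 * \<tau>"
proof -
  have "mom (a * b1) (a * \<tau>) \<le> a * b1 * (a * \<tau>)"
    using mom_le[OF a_pos(2), of "a * \<tau>" 0] by simp
  then show ?thesis using a_pos
    by (simp add: foot_prof_def divide_simps power2_eq_square mult_ac flip: a_def)
qed

lemma foot_prof_le':
  assumes "\<tau> \<le> b1 + b2"
  shows "foot_prof b1 b2 \<tau> \<le> b2 * (b1 + b2 - \<tau>)"
proof -
  have "(1 - a * b1) * exp (a * (b1 + b2)) = 1 + a * b2"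
    using mom_end by (simp add: mom_def algebra_simps)
  then have "mom (a * b1) (a * \<tau>) \<le> (- (a * b2)) * (a * \<tau> - a * (b1 + b2))"
    using mom_le[OF a_pos(2), of "a * \<tau>" "a * (b1 + b2)"] mom_end by simp
  also have "\<dots> = a\<^sup>2 * (b2 * (b1 + b2 - \<tau>))" by (simp add: power2_eq_square algebra_simps)
  finally show ?thesis using a_pos
    by (simp add: foot_prof_def divide_simps mult_ac flip: a_def)
qed

end

section \<open>Existence of the football potential\<close>

text \<open>The solution is the inverse of S, an antiderivative of 1 / F. The linear bounds make S
  diverge at least logarithmically at both ends, so S maps (0, L) onto the whole line and the
  solution is global.\<close>

lemma separable_ode_exists:
  fixes F :: "real \<Rightarrow> real"
  assumes L: "0 < L" and b: "0 < b1" "0 < b2"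
    and cont: "\<And>x. 0 < x \<Longrightarrow> x < L \<Longrightarrow> isCont F x"
    and pos: "\<And>x. 0 < x \<Longrightarrow> x < L \<Longrightarrow> F x > 0"
    and le: "\<And>x. 0 < x \<Longrightarrow> x < L \<Longrightarrow> F x \<le> b1 * x"
    and le': "\<And>x. 0 < x \<Longrightarrow> x < L \<Longrightarrow> F x \<le> b2 * (L - x)"
  obtains \<phi> where "\<And>s. 0 < \<phi> s \<and> \<phi> s < L" "\<And>s. (\<phi> has_real_derivative F (\<phi> s)) (at s)"
    "(\<phi> \<longlongrightarrow> 0) at_bot" "(\<phi> \<longlongrightarrow> L) at_top"
proof -
  have isC: "isCont (\<lambda>x. 1 / F x) x" if "0 < x" "x < L" for x
  proof -
    have "F x \<noteq> 0" using pos[OF that] by simp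
    then show ?thesis using cont[OF that] by (intro isCont_divide continuous_const)
  qed
  have "\<exists>S. \<forall>x. ereal 0 < ereal x \<longrightarrow> ereal x < ereal L \<longrightarrow>
      (S has_vector_derivative 1 / F x) (at x)"
    using L isC by (intro einterval_antiderivative) auto
  then obtain S where S: "\<And>x. 0 < x \<Longrightarrow> x < L \<Longrightarrow> (S has_real_derivative 1 / F x) (at x)"
    by (auto simp: has_real_derivative_iff_has_vector_derivative)
  define m where "m = L / 2"
  have m: "0 < m" "m < L" using L by (auto simp: m_def)
  have Sinc: "S x < S y" if "0 < x" "x < y" "y < L" for x y
  proof (rule DERIV_pos_imp_increasing[OF that(2)])
    fix t assume "x \<le> t" "t \<le> y"
    then have t: "0 < t" "t < L" using that by auto
    show "\<exists>d. (S has_real_derivative d) (at t) \<and> 0 < d"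
      using S[OF t] pos[OF t] by (intro exI[of _ "1 / F t"]) simp
  qed
  have low: "S x \<le> S m + (ln x - ln m) / b1" if "0 < x" "x \<le> m" for x
  proof -
    have "S x - ln x / b1 \<le> S m - ln m / b1"
    proof (rule DERIV_nonneg_imp_nondecreasing[OF that(2)])
      fix t assume t: "x \<le> t" "t \<le> m"
      then have t': "0 < t" "t < L" using that m by auto
      have "1 / (b1 * t) \<le> 1 / F t"
        using le[OF t'] pos[OF t'] t' b by (intro divide_left_mono) auto
      then show "\<exists>y. ((\<lambda>t. S t - ln t / b1) has_real_derivative y) (at t) \<and> 0 \<le> y"
        using t' by (intro exI[of _ "1 / F t - 1 / t / b1"] conjI DERIV_diff S DERIV_cdivide)
          (auto intro!: derivative_eq_intros simp: mult.commute)
    qed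
    then show ?thesis by (simp add: diff_divide_distrib)
  qed
  have high: "S x \<ge> S m + (ln (L - m) - ln (L - x)) / b2" if "m \<le> x" "x < L" for x
  proof -
    have "S m + ln (L - m) / b2 \<le> S x + ln (L - x) / b2"
    proof (rule DERIV_nonneg_imp_nondecreasing[OF that(1)])
      fix t assume t: "m \<le> t" "t \<le> x"
      then have t': "0 < t" "t < L" using that m by auto
      have "1 / (b2 * (L - t)) \<le> 1 / F t"
        using le'[OF t'] pos[OF t'] t' b by (intro divide_left_mono) auto
      then show "\<exists>y. ((\<lambda>t. S t + ln (L - t) / b2) has_real_derivative y) (at t) \<and> 0 \<le> y"
        using t' by (intro exI[of _ "1 / F t + (- 1) / (L - t) / b2"] conjI DERIV_add S DERIV_cdivide)
          (auto intro!: derivative_eq_intros simp: mult.commute)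
    qed
    then show ?thesis by (simp add: diff_divide_distrib)
  qed
  have surj: "\<exists>x. 0 < x \<and> x < L \<and> S x = s" for s
  proof -
    \<comment> \<open>Obtained by solving the bound \<open>low\<close> for a point with S x at most
      s; the minimum keeps it in the range where \<open>low\<close> applies. The point
      \<open>y\<close> below is the mirror image for \<open>high\<close>.\<close>
    define x where "x = min m (m * exp (b1 * (s - S m)))"
    have x: "0 < x" "x \<le> m" using m by (auto simp: x_def)
    have "ln x \<le> ln (m * exp (b1 * (s - S m)))" using x by (subst ln_le_cancel_iff) (auto simp: x_def m)
    also have "\<dots> = ln m + b1 * (s - S m)" using m by (simp add: ln_mult)
    finally have "(ln x - ln m) / b1 \<le> s - S m" using b by (simp add: field_simps)
    then have 1: "S x \<le> s" using low[OF x] by simp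
    define y where "y = L - min (L - m) ((L - m) * exp (b2 * (S m - s)))"
    have y: "m \<le> y" "y < L" using m by (auto simp: y_def)
    have "ln (L - y) \<le> ln ((L - m) * exp (b2 * (S m - s)))"
      using y m by (subst ln_le_cancel_iff) (auto simp: y_def)
    also have "\<dots> = ln (L - m) + b2 * (S m - s)" using m by (simp add: ln_mult)
    finally have "s - S m \<le> (ln (L - m) - ln (L - y)) / b2" using b by (simp add: field_simps)
    then have 2: "s \<le> S y" using high[OF y] by simp
    have "\<exists>z\<ge>x. z \<le> y \<and> S z = s"
    proof (rule IVT'[of S x s y, OF 1 2])
      show "x \<le> y" using x y by simp
      show "continuous_on {x..y} S"
        by (intro continuous_at_imp_continuous_on ballI DERIV_isCont[OF S]) (use x y in auto)
    qed
    then obtain z where "x \<le> z" "z \<le> y" "S z = s" by blast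
    then show ?thesis using x y by (intro exI[of _ z]) auto
  qed
  define \<phi> where "\<phi> s = (SOME x. 0 < x \<and> x < L \<and> S x = s)" for s
  have \<phi>: "0 < \<phi> s \<and> \<phi> s < L \<and> S (\<phi> s) = s" for s
    unfolding \<phi>_def by (rule someI_ex[OF surj])
  have \<phi>0: "0 < \<phi> s" and \<phi>L: "\<phi> s < L" and S\<phi>: "S (\<phi> s) = s" for s using \<phi>[of s] by auto
  have inv: "\<phi> (S x) = x" if "0 < x" "x < L" for x
    using \<phi>[of "S x"] Sinc[of x "\<phi> (S x)"] Sinc[of "\<phi> (S x)" x] that
    by (cases x "\<phi> (S x)" rule: linorder_cases) auto
  have less: "\<phi> s < x \<longleftrightarrow> s < S x" if "0 < x" "x < L" for s x
    using Sinc[of "\<phi> s" x] Sinc[of x "\<phi> s"] \<phi>[of s] that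
    by (cases x "\<phi> s" rule: linorder_cases) auto
  have mono: "\<phi> s \<le> \<phi> t" if "s \<le> t" for s t
  proof -
    have "\<phi> t < \<phi> s \<longleftrightarrow> t < S (\<phi> s)" using \<phi>[of s] by (intro less) auto
    then show ?thesis using \<phi>[of s] that by auto
  qed
  have range: "\<phi> ` UNIV = {0<..<L}"
  proof -
    have "x \<in> range \<phi>" if "0 < x" "x < L" for x
      using inv[OF that] by (metis rangeI)
    then show ?thesis using \<phi> by auto
  qed
  \<comment> \<open>A monotone function with open image has no jumps; the inverse function rule for
    derivatives requires this continuity.\<close>
  have cont\<phi>: "isCont \<phi> s" for s
    using continuous_onI_mono[of \<phi> UNIV] mono range by (simp add: continuous_on_eq_continuous_at)
  show thesis
  proof
    show "0 < \<phi> s \<and> \<phi> s < L" for s using \<phi>0 \<phi>L by simp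
    show "(\<phi> has_real_derivative F (\<phi> s)) (at s)" for s
    proof -
      have ne: "F (\<phi> s) \<noteq> 0" using pos[of "\<phi> s"] \<phi>[of s] by linarith
      have "(\<phi> has_real_derivative inverse (1 / F (\<phi> s))) (at s)"
      proof (rule DERIV_inverse_function[where f = S and a = "s - 1" and b = "s + 1"])
        show "(S has_real_derivative 1 / F (\<phi> s)) (at (\<phi> s))" by (rule S[OF \<phi>0 \<phi>L])
      qed (use ne in \<open>simp_all add: S\<phi> cont\<phi>\<close>)
      then show ?thesis by simp
    qed
    show "(\<phi> \<longlongrightarrow> 0) at_bot"
    proof (rule order_tendstoI)
      fix y :: real assume y: "0 < y"
      define x where "x = min y m"
      have x: "0 < x" "x < L" "x \<le> y" using y m by (auto simp: x_def)
      have "\<phi> s < y" if "s < S x" for s using less[OF x(1,2), of s] that x(3) by linarith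
      then show "eventually (\<lambda>s. \<phi> s < y) at_bot"
        by (intro eventually_mono[OF eventually_gt_at_bot[of "S x"]])
    qed (intro always_eventually allI, erule less_trans, rule \<phi>0)
    show "(\<phi> \<longlongrightarrow> L) at_top"
    proof (rule order_tendstoI)
      fix y :: real assume y: "y < L"
      define x where "x = max y m"
      have x: "0 < x" "x < L" "y \<le> x" using y m by (auto simp: x_def)
      have "y < \<phi> s" if "S x < s" for s
      proof -
        have "\<phi> s \<noteq> x" using \<phi>[of s] that by auto
        then show ?thesis using less[OF x(1,2), of s] that x(3) by linarith
      qed
      then show "eventually (\<lambda>s. y < \<phi> s) at_top"
        by (intro eventually_mono[OF eventually_gt_at_top[of "S x"]])
    qed (intro always_eventually allI, rule less_trans, rule \<phi>L)
  qed
qed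

text \<open>The polynomials in x and e^(a x). They contain the profile and are closed under
  differentiation, which controls the iterated derivatives of the potential at every order.\<close>

inductive exp_poly :: "real \<Rightarrow> (real \<Rightarrow> real) \<Rightarrow> bool" for a where
  exp_poly_const: "exp_poly a (\<lambda>_. r)"
| exp_poly_id: "exp_poly a (\<lambda>x. x)"
| exp_poly_exp: "exp_poly a (\<lambda>x. exp (a * x))"
| exp_poly_add: "exp_poly a f \<Longrightarrow> exp_poly a g \<Longrightarrow> exp_poly a (\<lambda>x. f x + g x)"
| exp_poly_mult: "exp_poly a f \<Longrightarrow> exp_poly a g \<Longrightarrow> exp_poly a (\<lambda>x. f x * g x)"

lemma exp_poly_deriv:
  "exp_poly a f \<Longrightarrow> \<exists>f'. exp_poly a f' \<and> (\<forall>x. (f has_real_derivative f' x) (at x))"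
proof (induction rule: exp_poly.induct)
  case (exp_poly_const r)
  then show ?case by (auto intro!: exI[of _ "\<lambda>_. 0"] exp_poly.intros)
next
  case exp_poly_id
  then show ?case by (auto intro!: exI[of _ "\<lambda>_. 1"] exp_poly.intros)
next
  case exp_poly_exp
  have "exp_poly a (\<lambda>x. a * exp (a * x))" by (intro exp_poly.intros)
  then show ?case
    by (intro exI[of _ "\<lambda>x. a * exp (a * x)"]) (auto intro!: derivative_eq_intros)
next
  case (exp_poly_add f g)
  then show ?case by (blast intro: exp_poly.intros DERIV_add)
next
  case (exp_poly_mult f g)
  then obtain f' g' where *: "exp_poly a f'" "\<forall>x. (f has_real_derivative f' x) (at x)"
    "exp_poly a g'" "\<forall>x. (g has_real_derivative g' x) (at x)" by blast
  with exp_poly_mult.hyps have "exp_poly a (\<lambda>x. f' x * g x + g' x * f x)"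
    by (intro exp_poly.intros)
  with * show ?case by (blast intro: DERIV_mult)
qed

lemma exp_poly_foot_prof: "exp_poly (a_par b1 b2) (foot_prof b1 b2)"
proof -
  define a where "a = a_par b1 b2"
  have "exp_poly a (\<lambda>x. (1 / a\<^sup>2) * (a * x + (1 - a * b1) * (1 + (- 1) * exp (a * x))))"
    by (intro exp_poly.intros)
  moreover have "foot_prof b1 b2 = (\<lambda>x. (1 / a\<^sup>2) * (a * x + (1 - a * b1) * (1 + (- 1) * exp (a * x))))"
    by (rule ext) (simp add: foot_prof_def mom_def a_def)
  ultimately show ?thesis by (simp add: a_def)
qed

lemma football_pot_exists:
  assumes b: "0 < b1" "b1 < b2"
  shows "\<exists>f. football_pot b1 b2 f"
proof -
  define a where "a = a_par b1 b2"
  define F where "F = foot_prof b1 b2"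
  have dF: "(F has_real_derivative a * F x + b1 - x) (at x)" for x
    using foot_prof_deriv[OF b] by (simp add: F_def a_def)
  obtain \<phi> where \<phi>: "\<And>s. 0 < \<phi> s \<and> \<phi> s < b1 + b2"
      "\<And>s. (\<phi> has_real_derivative F (\<phi> s)) (at s)"
      "(\<phi> \<longlongrightarrow> 0) at_bot" "(\<phi> \<longlongrightarrow> b1 + b2) at_top"
    by (rule separable_ode_exists[of "b1 + b2" b1 b2 F])
      (use b foot_prof_pos[OF b] foot_prof_le[OF b] foot_prof_le'[OF b] DERIV_isCont[OF dF]
        in \<open>auto simp: F_def\<close>)
  have "\<exists>f. \<forall>x. -\<infinity> < ereal x \<longrightarrow> ereal x < \<infinity> \<longrightarrow> (f has_vector_derivative \<phi> x) (at x)"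
    by (intro einterval_antiderivative) (auto intro: DERIV_isCont[OF \<phi>(2)])
  then obtain f where f: "\<And>s. (f has_real_derivative \<phi> s) (at s)"
    by (auto simp: has_real_derivative_iff_has_vector_derivative)
  have d1: "deriv f = \<phi>" using f by (auto intro: DERIV_imp_deriv)
  \<comment> \<open>The class is preserved because the derivative of \<open>P (\<phi> s)\<close> is
    \<open>P' F\<close> evaluated at \<open>\<phi> s\<close>.\<close>
  have smooth: "\<exists>P. exp_poly a P \<and> (deriv ^^ Suc k) f = (\<lambda>s. P (\<phi> s))" for k
  proof (induction k)
    case 0
    then show ?case using d1 by (auto intro!: exI[of _ "\<lambda>x. x"] exp_poly.intros)
  next
    case (Suc k)
    then obtain P where P: "exp_poly a P" "(deriv ^^ Suc k) f = (\<lambda>s. P (\<phi> s))" by blast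
    obtain P' where P': "exp_poly a P'" "\<And>x. (P has_real_derivative P' x) (at x)"
      using exp_poly_deriv[OF P(1)] by blast
    have "(deriv ^^ Suc (Suc k)) f = deriv (\<lambda>s. P (\<phi> s))" unfolding P(2)[symmetric] by simp
    also have "\<dots> = (\<lambda>s. P' (\<phi> s) * F (\<phi> s))"
      by (intro ext DERIV_imp_deriv DERIV_chain2[OF P'(2) \<phi>(2)])
    finally show ?case using P'(1) exp_poly_foot_prof[of b1 b2]
      by (intro exI[of _ "\<lambda>x. P' x * F x"]) (auto intro!: exp_poly.intros simp: F_def a_def)
  qed
  have diff: "(deriv ^^ k) f differentiable (at s)" for k s
  proof (cases k)
    case 0
    then show ?thesis using f by (auto simp: real_differentiable_def)
  next
    case (Suc j)
    then obtain P where P: "exp_poly a P" "(deriv ^^ k) f = (\<lambda>s. P (\<phi> s))"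
      using smooth[of j] by blast
    obtain P' where P': "exp_poly a P'" "\<And>x. (P has_real_derivative P' x) (at x)"
      using exp_poly_deriv[OF P(1)] by blast
    show ?thesis unfolding P(2)
      using DERIV_chain2[OF P'(2) \<phi>(2)] by (auto simp: real_differentiable_def)
  qed
  have d2: "(deriv ^^ 2) f = (\<lambda>s. F (\<phi> s))"
    using \<phi>(2) d1 by (auto simp: eval_nat_numeral intro: DERIV_imp_deriv)
  have dF\<phi>: "((\<lambda>s. F (\<phi> s)) has_real_derivative (a * F (\<phi> s) + b1 - \<phi> s) * F (\<phi> s)) (at s)" for s
    by (rule DERIV_chain2[OF dF \<phi>(2)])
  have d3: "(deriv ^^ 3) f = (\<lambda>s. (a * F (\<phi> s) + b1 - \<phi> s) * F (\<phi> s))"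
  proof -
    have "(deriv ^^ 3) f = deriv ((deriv ^^ 2) f)" by (simp add: eval_nat_numeral)
    then show ?thesis unfolding d2 using dF\<phi> by (auto intro: DERIV_imp_deriv)
  qed
  have Fpos: "F (\<phi> s) > 0" for s using foot_prof_pos[OF b] \<phi>(1) by (simp add: F_def)
  have quot: "(\<lambda>s. (deriv ^^ 3) f s / (deriv ^^ 2) f s) = (\<lambda>s. a * F (\<phi> s) + b1 - \<phi> s)"
    unfolding d2 d3 using Fpos by (auto simp: fun_eq_iff less_imp_neq[THEN not_sym])
  have F0: "F 0 = 0" "F (b1 + b2) = 0" using foot_prof_ends[OF b] by (auto simp: F_def)
  \<comment> \<open>Since F vanishes at both ends, the two limits are b1 and b1 - (b1 + b2) = - b2,
    as the cone angles demand.\<close>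
  have lim0: "((\<lambda>s. a * F (\<phi> s) + b1 - \<phi> s) \<longlongrightarrow> a * F 0 + b1 - 0) at_bot"
    by (intro tendsto_intros \<phi> isCont_tendsto_compose[OF DERIV_isCont[OF dF]])
  have lim1: "((\<lambda>s. a * F (\<phi> s) + b1 - \<phi> s) \<longlongrightarrow> a * F (b1 + b2) + b1 - (b1 + b2)) at_top"
    by (intro tendsto_intros \<phi> isCont_tendsto_compose[OF DERIV_isCont[OF dF]])
  have ln1: "deriv (\<lambda>t. ln (F (\<phi> t))) = (\<lambda>s. a * F (\<phi> s) + b1 - \<phi> s)"
  proof (intro ext DERIV_imp_deriv)
    fix s
    show "((\<lambda>t. ln (F (\<phi> t))) has_real_derivative a * F (\<phi> s) + b1 - \<phi> s) (at s)"
      using DERIV_chain2[OF DERIV_ln_divide[OF Fpos] dF\<phi>, of s] Fpos[of s] by simp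
  qed
  have ln2: "deriv (\<lambda>s. a * F (\<phi> s) + b1 - \<phi> s) s = a * ((a * F (\<phi> s) + b1 - \<phi> s) * F (\<phi> s)) - F (\<phi> s)" for s
    using dF\<phi>[of s] \<phi>(2)[of s] by (intro DERIV_imp_deriv) (auto intro!: derivative_eq_intros)
  have "\<forall>s. - deriv (deriv (\<lambda>t. ln ((deriv ^^ 2) f t))) s
                  = (deriv ^^ 2) f s - 2 * (a / 2) * (deriv ^^ 3) f s"
    unfolding d2 d3 ln1 ln2 by simp
  then have "\<exists>lam. \<forall>s. - deriv (deriv (\<lambda>t. ln ((deriv ^^ 2) f t))) s
                  = (deriv ^^ 2) f s - 2 * lam * (deriv ^^ 3) f s" by blast
  then show ?thesis
    unfolding football_pot_def
    using diff \<phi>(3,4) lim0 lim1 F0 d1 d2 Fpos quot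
    by (intro exI[of _ f] conjI) simp_all
qed

section \<open>The soliton equation in the moment coordinate\<close>

text \<open>Near minus infinity ln u grows at rate more than l / 2, so u is dominated by an
  exponential. Applied to f'', this turns the angle condition at N into decay, which the definition
  of a potential does not state.\<close>

lemma log_deriv_pos_imp_tendsto_0_at_bot:
  fixes u :: "real \<Rightarrow> real"
  assumes u: "\<And>s. u s > 0" "\<And>s. (u has_real_derivative u' s) (at s)"
    and lim: "((\<lambda>s. u' s / u s) \<longlongrightarrow> l) at_bot" and "l > 0"
  shows "(u \<longlongrightarrow> 0) at_bot"
proof -
  have "eventually (\<lambda>s. l / 2 < u' s / u s) at_bot"
    using order_tendstoD(1)[OF lim, of "l / 2"] \<open>l > 0\<close> by simp
  then obtain s0 where s0: "\<And>s. s \<le> s0 \<Longrightarrow> l / 2 < u' s / u s"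
    by (auto simp: eventually_at_bot_linorder)
  have bd: "u s \<le> u s0 * exp (l / 2 * (s - s0))" if "s \<le> s0" for s
  proof -
    have "ln (u s) - l / 2 * s \<le> ln (u s0) - l / 2 * s0"
    proof (rule DERIV_nonneg_imp_nondecreasing[OF that])
      fix t assume "s \<le> t" "t \<le> s0"
      then show "\<exists>y. ((\<lambda>s. ln (u s) - l / 2 * s) has_real_derivative y) (at t) \<and> 0 \<le> y"
        using s0[of t] u(1)[of t]
        by (intro exI[of _ "u' t / u t - l / 2"]) (auto intro!: derivative_eq_intros u(2) simp: field_simps)
    qed
    moreover have "l / 2 * (s - s0) = l / 2 * s - l / 2 * s0" by (rule right_diff_distrib)
    ultimately have "ln (u s) \<le> ln (u s0) + l / 2 * (s - s0)" by linarith
    then have "exp (ln (u s)) \<le> exp (ln (u s0) + l / 2 * (s - s0))" by (subst exp_le_cancel_iff)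
    then show ?thesis using u(1) by (simp add: exp_add)
  qed
  have lin: "filterlim (\<lambda>s. l / 2 * (s - s0)) at_bot at_bot"
    unfolding filterlim_at_bot
  proof
    fix Z
    show "eventually (\<lambda>s. l / 2 * (s - s0) \<le> Z) at_bot"
      using eventually_le_at_bot[of "s0 + 2 * Z / l"] \<open>l > 0\<close>
      by (auto elim!: eventually_mono simp: field_simps)
  qed
  have "((\<lambda>s. u s0 * exp (l / 2 * (s - s0))) \<longlongrightarrow> u s0 * 0) at_bot"
    by (intro tendsto_intros filterlim_compose[OF exp_at_bot lin])
  then show ?thesis
    by (intro tendsto_sandwich[of "\<lambda>_. 0" u at_bot "\<lambda>s. u s0 * exp (l / 2 * (s - s0))" 0])
      (use u(1) bd in \<open>auto simp: eventually_at_bot_linorder intro: less_imp_le always_eventually\<close>)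
qed

lemma log_deriv_neg_imp_tendsto_0_at_top:
  fixes u :: "real \<Rightarrow> real"
  assumes u: "\<And>s. u s > 0" "\<And>s. (u has_real_derivative u' s) (at s)"
    and lim: "((\<lambda>s. u' s / u s) \<longlongrightarrow> l) at_top" and "l < 0"
  shows "(u \<longlongrightarrow> 0) at_top"
proof -
  have "((\<lambda>s. u (- s)) \<longlongrightarrow> 0) at_bot"
  proof (rule log_deriv_pos_imp_tendsto_0_at_bot)
    show "((\<lambda>s. u (- s)) has_real_derivative - u' (- s)) (at s)" for s
      using DERIV_chain2[OF u(2) DERIV_minus[OF DERIV_ident], of s] by simp
    show "((\<lambda>s. - u' (- s) / u (- s)) \<longlongrightarrow> - l) at_bot"
      using tendsto_minus[OF lim] by (simp add: filterlim_at_top_mirror)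
  qed (use u \<open>l < 0\<close> in auto)
  then show ?thesis by (simp add: filterlim_at_top_mirror)
qed

lemma DERIV_0_tendsto_at_bot_unique:
  fixes h :: "real \<Rightarrow> real"
  assumes "\<And>s. (h has_real_derivative 0) (at s)" "(h \<longlongrightarrow> l) at_bot"
  shows "h s = l"
proof -
  have "h t = h s" for t using DERIV_isconst_all[of h t s] assms(1) by blast
  then have "(h \<longlongrightarrow> h s) at_bot" by (simp add: tendsto_eventually always_eventually)
  with assms(2) show ?thesis by (intro tendsto_unique[of at_bot h]) auto
qed

lemma football_pot_derivs:
  assumes "football_pot b1 b2 f"
  shows "((deriv ^^ k) f has_real_derivative (deriv ^^ Suc k) f s) (at s)"
proof -
  have "(deriv ^^ k) f differentiable (at s)" using assms by (simp add: football_pot_def)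
  then show ?thesis by (simp add: DERIV_deriv_iff_real_differentiable)
qed

text \<open>The soliton equation is integrated twice, with both constants fixed at N by the cone
  angle and by the decay of f' and f''. The conditions at S then determine the soliton constant.
  Thus the profile is independent of the chosen potential.\<close>

lemma football_pot_profile:
  assumes b: "0 < b1" "b1 < b2" and f: "football_pot b1 b2 f"
  shows "(deriv ^^ 2) f s = foot_prof b1 b2 (deriv f s)"
proof -
  define \<phi> where "\<phi> = deriv f"
  define u where "u = (deriv ^^ 2) f"
  define u' where "u' = (deriv ^^ 3) f"
  have d\<phi>: "(\<phi> has_real_derivative u s) (at s)" for s
    using football_pot_derivs[OF f, of 1 s] by (simp add: \<phi>_def u_def eval_nat_numeral)
  have du: "(u has_real_derivative u' s) (at s)" for s
    using football_pot_derivs[OF f, of 2 s] by (simp add: u'_def u_def eval_nat_numeral)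
  have du': "(u' has_real_derivative (deriv ^^ 4) f s) (at s)" for s
    using football_pot_derivs[OF f, of 3 s] by (simp add: u'_def eval_nat_numeral)
  have upos: "u s > 0" for s using f by (simp add: u_def football_pot_def)
  have lims: "(\<phi> \<longlongrightarrow> 0) at_bot" "(\<phi> \<longlongrightarrow> b1 + b2) at_top"
    "((\<lambda>s. u' s / u s) \<longlongrightarrow> b1) at_bot" "((\<lambda>s. u' s / u s) \<longlongrightarrow> - b2) at_top"
    using f by (auto simp: football_pot_def u_def u'_def \<phi>_def)
  obtain lam where lam: "- deriv (deriv (\<lambda>t. ln (u t))) s = u s - 2 * lam * u' s" for s
    using f unfolding football_pot_def u_def u'_def by blast
  define \<mu> where "\<mu> = 2 * lam"
  have u0: "(u \<longlongrightarrow> 0) at_bot"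
    by (rule log_deriv_pos_imp_tendsto_0_at_bot[OF upos du lims(3) b(1)])
  have u1: "(u \<longlongrightarrow> 0) at_top"
    by (rule log_deriv_neg_imp_tendsto_0_at_top[OF upos du lims(4)]) (use b in simp)
  have dlog: "((\<lambda>s. u' s / u s) has_real_derivative - (u s - \<mu> * u' s)) (at s)" for s
  proof -
    have "deriv (\<lambda>t. ln (u t)) = (\<lambda>s. u' s / u s)"
      using DERIV_chain2[OF DERIV_ln_divide[OF upos] du] by (auto intro!: DERIV_imp_deriv)
    then have "deriv (\<lambda>s. u' s / u s) s = - (u s - \<mu> * u' s)"
      using lam[of s] by (simp add: \<mu>_def)
    moreover have "(\<lambda>s. u' s / u s) differentiable (at s)"
      using DERIV_divide[OF du' du, of s] upos[of s] by (auto simp: real_differentiable_def)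
    ultimately show ?thesis by (metis DERIV_deriv_iff_real_differentiable)
  qed
  \<comment> \<open>A first integral of the soliton equation; its value is its limit at N.\<close>
  have "u' s / u s + \<phi> s - \<mu> * u s = b1" for s
  proof (rule DERIV_0_tendsto_at_bot_unique[where h = "\<lambda>s. u' s / u s + \<phi> s - \<mu> * u s"])
    show "((\<lambda>s. u' s / u s + \<phi> s - \<mu> * u s) has_real_derivative 0) (at s)" for s
      using DERIV_diff[OF DERIV_add[OF dlog d\<phi>] DERIV_cmult[OF du, where c = \<mu>]] by simp
    have "((\<lambda>s. u' s / u s + \<phi> s - \<mu> * u s) \<longlongrightarrow> b1 + 0 - \<mu> * 0) at_bot"
      by (intro tendsto_intros lims u0)
    then show "((\<lambda>s. u' s / u s + \<phi> s - \<mu> * u s) \<longlongrightarrow> b1) at_bot" by simp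
  qed
  then have quot: "u' s / u s = b1 - \<phi> s + \<mu> * u s" for s
    by (smt (verit))
  have ode: "u' s = u s * (b1 - \<phi> s + \<mu> * u s)" for s
    unfolding quot[symmetric] using upos[of s] by simp
  \<comment> \<open>With vanishing soliton constant the profile would be
    \<open>b1 \<tau> - \<tau>\<^sup>2 / 2\<close>, with zeros 0 and 2 b1; a zero at b1 + b2 would
    force equal angles.\<close>
  have "\<mu> \<noteq> 0"
  proof
    assume \<mu>: "\<mu> = 0"
    have "u s - b1 * \<phi> s + (\<phi> s)\<^sup>2 / 2 = 0" for s
    proof (rule DERIV_0_tendsto_at_bot_unique[where h = "\<lambda>s. u s - b1 * \<phi> s + (\<phi> s)\<^sup>2 / 2"])
      show "((\<lambda>s. u s - b1 * \<phi> s + (\<phi> s)\<^sup>2 / 2) has_real_derivative 0) (at s)" for s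
        by (auto intro!: derivative_eq_intros d\<phi> du simp: ode \<mu> algebra_simps)
      have "((\<lambda>s. u s - b1 * \<phi> s + (\<phi> s)\<^sup>2 / 2) \<longlongrightarrow> 0 - b1 * 0 + 0\<^sup>2 / 2) at_bot"
        by (intro tendsto_intros lims u0) auto
      then show "((\<lambda>s. u s - b1 * \<phi> s + (\<phi> s)\<^sup>2 / 2) \<longlongrightarrow> 0) at_bot" by simp
    qed
    moreover have "((\<lambda>s. u s - b1 * \<phi> s + (\<phi> s)\<^sup>2 / 2) \<longlongrightarrow> 0 - b1 * (b1 + b2) + (b1 + b2)\<^sup>2 / 2) at_top"
      by (intro tendsto_intros lims u1) auto
    ultimately have "0 - b1 * (b1 + b2) + (b1 + b2)\<^sup>2 / 2 = 0"
      by (simp add: tendsto_const_iff)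
    then have "(b1 + b2) * (b2 - b1) = 0" by (simp add: power2_eq_square algebra_simps)
    with b show False by simp
  qed
  define M where "M t = mom (\<mu> * b1) (\<mu> * t) / \<mu>\<^sup>2" for t
  have dM: "(M has_real_derivative \<mu> * M t + b1 - t) (at t)" for t
  proof -
    have "((\<lambda>t. mom (\<mu> * b1) (\<mu> * t) / \<mu>\<^sup>2) has_real_derivative
        (1 - (1 - \<mu> * b1) * exp (\<mu> * t)) * \<mu> / \<mu>\<^sup>2) (at t)"
      by (intro DERIV_cdivide DERIV_chain2[OF mom_deriv]) (auto intro!: derivative_eq_intros)
    moreover have "(1 - (1 - \<mu> * b1) * exp (\<mu> * t)) * \<mu> / \<mu>\<^sup>2 = \<mu> * M t + b1 - t"
      using \<open>\<mu> \<noteq> 0\<close> unfolding M_def mom_def by (simp add: field_simps power2_eq_square)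
    ultimately show ?thesis by (simp add: M_def[abs_def])
  qed
  have M0: "M 0 = 0" by (simp add: M_def)
  have limM: "((\<lambda>s. M (\<phi> s)) \<longlongrightarrow> M l) F" if "(\<phi> \<longlongrightarrow> l) F" for l F
    using that by (rule isCont_tendsto_compose[OF DERIV_isCont[OF dM]])
  have uM: "u s = M (\<phi> s)" for s
  proof -
    \<comment> \<open>Both \<open>u\<close> and M along \<open>\<phi>\<close> satisfy the same
      linear equation in the variable \<open>\<phi>\<close>, and the exponential is its integrating
      factor.\<close>
    have "(u s - M (\<phi> s)) * exp (- \<mu> * \<phi> s) = 0"
    proof (rule DERIV_0_tendsto_at_bot_unique[where h = "\<lambda>s. (u s - M (\<phi> s)) * exp (- \<mu> * \<phi> s)"])
      show "((\<lambda>s. (u s - M (\<phi> s)) * exp (- \<mu> * \<phi> s)) has_real_derivative 0) (at s)" for s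
        by (rule derivative_eq_intros d\<phi> du DERIV_chain2[OF dM] refl)+ (simp add: ode algebra_simps)
      have "((\<lambda>s. (u s - M (\<phi> s)) * exp (- \<mu> * \<phi> s)) \<longlongrightarrow> (0 - M 0) * exp (- \<mu> * 0)) at_bot"
        by (intro tendsto_intros lims u0 limM)
      then show "((\<lambda>s. (u s - M (\<phi> s)) * exp (- \<mu> * \<phi> s)) \<longlongrightarrow> 0) at_bot"
        by (simp add: M0)
    qed
    then show ?thesis by simp
  qed
  have "((\<lambda>s. u s - M (\<phi> s)) \<longlongrightarrow> 0 - M (b1 + b2)) at_top"
    by (intro tendsto_intros lims u1 limM)
  then have "M (b1 + b2) = 0" by (simp add: uM tendsto_const_iff)
  then have "par_fun b1 b2 \<mu> = 0"
    using \<open>\<mu> \<noteq> 0\<close> mom_par_fun[of b1 \<mu> b2] by (simp add: M_def mult.commute)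
  then have "\<mu> = a_par b1 b2" using a_par_eqI[OF b \<open>\<mu> \<noteq> 0\<close>] by simp
  then have "M = foot_prof b1 b2" by (auto simp: M_def foot_prof_def)
  with uM[of s] show ?thesis by (simp add: u_def \<phi>_def)
qed

lemma foot_pot:
  assumes "0 < b1" "b1 < b2"
  shows "football_pot b1 b2 (foot_pot b1 b2)"
  unfolding foot_pot_def by (rule someI_ex[OF football_pot_exists[OF assms]])

lemma foot_pot_moment:
  assumes b: "0 < b1" "b1 < b2"
  defines "\<phi> \<equiv> deriv (foot_pot b1 b2)"
  shows "(\<phi> has_real_derivative foot_prof b1 b2 (\<phi> s)) (at s)"
    and "0 < \<phi> s" "\<phi> s < b1 + b2"
    and "0 < t \<Longrightarrow> t < b1 + b2 \<Longrightarrow> \<exists>s. \<phi> s = t"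
proof -
  note f = foot_pot[OF b]
  show d: "(\<phi> has_real_derivative foot_prof b1 b2 (\<phi> s)) (at s)" for s
    using football_pot_derivs[OF f, of 1 s] football_pot_profile[OF b f, of s]
    by (simp add: \<phi>_def eval_nat_numeral)
  have pos: "foot_prof b1 b2 (\<phi> s) > 0" for s
    unfolding \<phi>_def football_pot_profile[OF b f, symmetric]
    using f unfolding football_pot_def by blast
  have inc: "\<phi> s < \<phi> t" if "s < t" for s t
    using DERIV_pos_imp_increasing[OF that] d pos by blast
  have lims: "(\<phi> \<longlongrightarrow> 0) at_bot" "(\<phi> \<longlongrightarrow> b1 + b2) at_top"
    using f by (auto simp: football_pot_def \<phi>_def)
  \<comment> \<open>The limit gives only a weak inequality; the shift by 1 and strict monotonicity
    make it strict.\<close>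
  have "0 \<le> \<phi> (s - 1)"
    by (rule tendsto_upperbound[OF lims(1)])
      (auto intro!: eventually_mono[OF eventually_le_at_bot[of "s - 1"]] 
        simp: le_less dest: inc)
  then show "0 < \<phi> s" using inc[of "s - 1" s] by simp
  have "\<phi> (s + 1) \<le> b1 + b2"
    by (rule tendsto_lowerbound[OF lims(2)])
      (auto intro!: eventually_mono[OF eventually_ge_at_top[of "s + 1"]] 
        simp: le_less dest: inc)
  then show "\<phi> s < b1 + b2" using inc[of s "s + 1"] by simp
  show "\<exists>s. \<phi> s = t" if t: "0 < t" "t < b1 + b2"
  proof -
    obtain s1 where s1: "\<phi> s1 < t"
      using order_tendstoD(2)[OF lims(1) t(1)] eventually_happens trivial_limit_at_bot_linorder
      by blast
    obtain s2 where s2: "t < \<phi> s2"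
      using order_tendstoD(1)[OF lims(2) t(2)] eventually_happens trivial_limit_at_top_linorder
      by blast
    have "s1 \<le> s2" using inc[of s2 s1] s1 s2 by linarith
    then have "\<exists>s\<ge>s1. s \<le> s2 \<and> \<phi> s = t"
      using s1 s2 d by (intro IVT') (auto intro!: continuous_at_imp_continuous_on DERIV_isCont)
    then show ?thesis by blast
  qed
qed

section \<open>The transported metric\<close>

lemma B_par_pos:
  assumes "0 < c" "c < 1"
  shows "B_par c > 0"
proof -
  have b: "b_par c > 0" using a_par_props(1)[OF assms] by (simp add: b_par_eq)
  then have "(b_par c)\<^sup>2 / 2 > 0" by simp
  then have "1 + b_par c < exp (b_par c)"
    using exp_lower_Taylor_quadratic[of "b_par c"] b by linarith
  then show ?thesis by (simp add: B_par_def exp_minus field_simps)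
qed

lemma inner_complex_mult_left: "inner (z * p) (z * q) = (cmod z)\<^sup>2 * inner p (q :: complex)"
  unfolding inner_complex_def cmod_power2 by (simp add: algebra_simps power2_eq_square)

text \<open>Here \<open>p = (a b1, 1 / a)\<close>. In these parameters the rescaled tensor extends smoothly to \<open>1 / a = 0\<close>,
  where the moment profile becomes independent of \<open>w\<close>. For \<open>w = r e\<^sup>i\<^sup>\<theta>\<close>, the real and imaginary parts
  of \<open>e / w\<close> are the values of \<open>dr / r\<close> and \<open>d\<theta>\<close> on \<open>e\<close>.\<close>
definition foot_limit_tensor :: "real \<Rightarrow> nat \<Rightarrow> nat \<Rightarrow> real \<times> real \<Rightarrow> complex \<Rightarrow> real" where
  "foot_limit_tensor B i j p w =
     (let G = mom (fst p) (fst p - 2 * B * snd p * ln (cmod w))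
      in 2 * B\<^sup>2 / ((fst p)\<^sup>2 * G) * (Re (basis2 i / w) * Re (basis2 j / w))
         + 2 * G / (fst p)\<^sup>2 * (Im (basis2 i / w) * Im (basis2 j / w)))"

context
  fixes b1 b2 c \<kappa> :: real and \<phi> :: "real \<Rightarrow> real"
  assumes b: "0 < b1" "b1 < b2" and c: "0 < c" "c < 1"
  defines "\<kappa> \<equiv> (a_par b1 b2)\<^sup>2 / (2 * B_par c)"
    and "\<phi> \<equiv> deriv (foot_pot b1 b2)"
begin

lemma kappa_pos: "\<kappa> > 0"
  using a_par_props(1)[OF b] B_par_pos[OF c] by (simp add: \<kappa>_def)

lemma Psi_unfold:
  "Psi c b1 b2 z = complex_of_real (exp (\<kappa> * (b1 - \<phi> (ln ((cmod z)\<^sup>2))))) * (z / complex_of_real (cmod z))"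
  by (simp add: Psi_def \<kappa>_def \<phi>_def Let_def)

lemma norm_Psi: "z \<noteq> 0 \<Longrightarrow> cmod (Psi c b1 b2 z) = exp (\<kappa> * (b1 - \<phi> (ln ((cmod z)\<^sup>2))))"
  by (simp add: Psi_unfold norm_mult norm_divide)

text \<open>The annulus is where the moment coordinate recovered from the norm of \<open>w\<close>
  lies in (0, b1 + b2). The preimage has the argument of \<open>w\<close> and the radius at which
  this moment is attained.\<close>

lemma in_Psi_image:
  assumes w: "w \<noteq> 0" "- (\<kappa> * b2) < ln (cmod w)" "ln (cmod w) < \<kappa> * b1"
  shows "w \<in> Psi c b1 b2 ` (- {0})"
proof -
  define \<tau> where "\<tau> = b1 - ln (cmod w) / \<kappa>"
  have \<tau>: "0 < \<tau>" "\<tau> < b1 + b2" using w kappa_pos by (auto simp: \<tau>_def field_simps)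
  then obtain s where s: "\<phi> s = \<tau>"
    using foot_pot_moment(4)[OF b \<tau>] by (auto simp: \<phi>_def)
  define z where "z = complex_of_real (exp (s / 2) / cmod w) * w"
  have nz: "cmod z = exp (s / 2)" using w by (simp add: z_def norm_mult norm_divide)
  have z0: "z \<noteq> 0" using nz by (metis exp_not_eq_zero norm_zero)
  have "ln ((cmod z)\<^sup>2) = s" by (simp add: nz power2_eq_square flip: exp_add)
  moreover have "\<kappa> * (b1 - \<tau>) = ln (cmod w)" using kappa_pos by (simp add: \<tau>_def)
  ultimately have "Psi c b1 b2 z = w"
    using w by (simp add: Psi_unfold s nz) (simp add: z_def)
  then show ?thesis using z0 by blast
qed

text \<open>In logarithmic polar coordinates \<open>Psi\<close> fixes the angle and changes only the
  radius, so its derivative is diagonal with entries \<open>- 2 \<kappa> F\<close> and 1; the 2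
  comes from s = 2 ln |z|.\<close>

lemma Psi_has_derivative:
  assumes z: "z \<noteq> 0"
  defines "F \<equiv> foot_prof b1 b2 (\<phi> (ln ((cmod z)\<^sup>2)))"
  shows "(Psi c b1 b2 has_derivative
    (\<lambda>v. Psi c b1 b2 z * Complex (- 2 * \<kappa> * F * Re (v / z)) (Im (v / z)))) (at z)"
proof -
  \<comment> \<open>Absorbing 1 / |z| as e^(- s / 2) writes \<open>Psi\<close> as z times a function
    of |z|^2, so the norm itself need not be differentiated.\<close>
  define g where "g s = exp (\<kappa> * (b1 - \<phi> s) - s / 2)" for s
  have dg: "(g has_real_derivative g s * (- \<kappa> * foot_prof b1 b2 (\<phi> s) - 1 / 2)) (at s)" for s
    unfolding g_def
    by (auto intro!: derivative_eq_intros foot_pot_moment(1)[OF b, folded \<phi>_def] simp: algebra_simps)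
  have Psi_g: "Psi c b1 b2 x = x * complex_of_real (g (ln (inner x x)))" if "x \<noteq> 0" for x
  proof -
    have "exp (- ln ((cmod x)\<^sup>2) / 2) = 1 / cmod x"
      using that by (simp add: ln_realpow exp_minus inverse_eq_divide)
    then have "g (ln ((cmod x)\<^sup>2)) = exp (\<kappa> * (b1 - \<phi> (ln ((cmod x)\<^sup>2)))) / cmod x"
      by (simp add: g_def diff_conv_add_uminus exp_add del: add_uminus_conv_diff)
    then show ?thesis by (simp add: Psi_unfold power2_norm_eq_inner mult.commute)
  qed
  define s where "s = ln (inner z z)"
  have s: "s = ln ((cmod z)\<^sup>2)" by (simp add: s_def power2_norm_eq_inner)
  have "((\<lambda>x. ln (inner x x)) has_derivative (\<lambda>v. (inner z v + inner v z) * (1 / inner z z))) (at z)"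
    by (rule DERIV_compose_FDERIV[OF DERIV_ln_divide has_derivative_inner[OF has_derivative_ident has_derivative_ident]])
      (use z in simp)
  from DERIV_compose_FDERIV[OF dg this]
  have "((\<lambda>x. g (ln (inner x x))) has_derivative
     (\<lambda>v. (inner z v + inner v z) * (1 / inner z z) * (g s * (- \<kappa> * F - 1 / 2)))) (at z)"
    by (simp add: F_def s flip: power2_norm_eq_inner)
  from has_derivative_mult[OF has_derivative_ident has_derivative_of_real[OF this]]
  have D: "((\<lambda>x. x * complex_of_real (g (ln (inner x x)))) has_derivative
     (\<lambda>v. z * complex_of_real ((inner z v + inner v z) * (1 / inner z z) * (g s * (- \<kappa> * F - 1 / 2)))
        + v * complex_of_real (g s))) (at z)"
    by (simp add: s_def)
  have eq: "z * complex_of_real ((inner z v + inner v z) * (1 / inner z z) * (g s * (- \<kappa> * F - 1 / 2)))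
        + v * complex_of_real (g s)
      = Psi c b1 b2 z * Complex (- 2 * \<kappa> * F * Re (v / z)) (Im (v / z))" for v
  proof -
    define q where "q = v / z"
    have v: "v = z * q" using z by (simp add: q_def)
    have "inner z v = (cmod z)\<^sup>2 * Re q"
      using inner_complex_mult_left[of z 1 q] by (simp add: v inner_complex_def)
    then have i: "(inner z v + inner v z) * (1 / inner z z) = 2 * Re q"
      using z by (simp add: inner_commute flip: power2_norm_eq_inner)
    have "of_real (2 * Re q * (g s * (- \<kappa> * F - 1 / 2))) + q * of_real (g s)
       = of_real (g s) * Complex (- 2 * \<kappa> * F * Re q) (Im q)"
      by (simp add: complex_eq_iff algebra_simps)
    then have "z * of_real (2 * Re q * (g s * (- \<kappa> * F - 1 / 2))) + v * of_real (g s)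
       = z * of_real (g s) * Complex (- 2 * \<kappa> * F * Re q) (Im q)"
      unfolding v by (metis (no_types, lifting) distrib_left mult.assoc)
    then show ?thesis unfolding i by (simp only: Psi_g[OF z] s_def q_def)
  qed
  show ?thesis
    by (rule has_derivative_transform_within_open[OF D[unfolded eq], of "- {0}"])
      (use z Psi_g in auto)
qed

lemma foot_tensor_eq:
  assumes w: "w \<noteq> 0" "- (\<kappa> * b2) < ln (cmod w)" "ln (cmod w) < \<kappa> * b1"
  shows "foot_tensor c b1 b2 i j w / b1\<^sup>2
    = foot_limit_tensor (B_par c) i j (a_par b1 b2 * b1, 1 / a_par b1 b2) w"
proof -
  define a where "a = a_par b1 b2"
  define B where "B = B_par c"
  have a: "a > 0" using a_par_props(1)[OF b] by (simp add: a_def)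
  have B: "B > 0" using B_par_pos[OF c] by (simp add: B_def)
  \<comment> \<open>Which preimage is picked is immaterial: \<open>w\<close> determines
    \<open>\<tau>\<close>, and the factors |z|^2 of the metric and of the inverse derivative
    cancel.\<close>
  define z where "z = inv_into (- {0}) (Psi c b1 b2) w"
  have z: "z \<noteq> 0" "Psi c b1 b2 z = w"
    using inv_into_into[OF in_Psi_image[OF w]] f_inv_into_f[OF in_Psi_image[OF w]]
    by (auto simp: z_def)
  define \<tau> where "\<tau> = \<phi> (ln ((cmod z)\<^sup>2))"
  define F where "F = foot_prof b1 b2 \<tau>"
  define G where "G = mom (a * b1) (a * b1 - 2 * B * (1 / a) * ln (cmod w))"
  have "ln (cmod w) = \<kappa> * (b1 - \<tau>)"
    using norm_Psi[OF z(1)] by (simp add: z \<tau>_def)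
  then have "a * \<tau> = a * b1 - 2 * B * (1 / a) * ln (cmod w)"
    using a B by (simp add: \<kappa>_def field_simps power2_eq_square flip: a_def B_def)
  then have FG: "F = G / a\<^sup>2" by (simp add: F_def G_def foot_prof_def flip: a_def)
  have "F > 0"
    using foot_prof_pos[OF b] foot_pot_moment(2,3)[OF b] by (simp add: F_def \<tau>_def \<phi>_def)
  then have G: "G > 0" using FG a by (simp add: zero_less_divide_iff)
  define D where "D v = w * Complex (- 2 * \<kappa> * F * Re (v / z)) (Im (v / z))" for v
  define L where "L e = z * Complex (- Re (e / w) / (2 * \<kappa> * F)) (Im (e / w))" for e
  have "frechet_derivative (Psi c b1 b2) (at z) = D"
    using frechet_derivative_at[OF Psi_has_derivative[OF z(1)], symmetric]
    by (simp add: D_def[abs_def] z F_def \<tau>_def)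
  moreover have "inv D = L"
  proof (rule inv_equality)
    have q: "(w * p) / w = p" "(z * p) / z = p" for p using z w by auto
    show "L (D v) = v" for v
      unfolding L_def D_def q using kappa_pos \<open>F > 0\<close> z by simp
    show "D (L e) = e" for e
      unfolding L_def D_def q using kappa_pos \<open>F > 0\<close> w by simp
  qed
  ultimately have L: "inv (frechet_derivative (Psi c b1 b2) (at z)) = L" by simp
  have f2: "(deriv ^^ 2) (foot_pot b1 b2) (ln ((cmod z)\<^sup>2)) = F"
    using football_pot_profile[OF b foot_pot[OF b]] by (simp add: F_def \<tau>_def \<phi>_def)
  let ?R = "Re (basis2 i / w) * Re (basis2 j / w)" and ?I = "Im (basis2 i / w) * Im (basis2 j / w)"
  have "inner (L (basis2 i)) (L (basis2 j)) = (cmod z)\<^sup>2 * (?R / (2 * \<kappa> * F)\<^sup>2 + ?I)"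
    unfolding L_def inner_complex_mult_left by (simp add: inner_complex_def power2_eq_square)
  then have "foot_tensor c b1 b2 i j w = 2 * F / (cmod z)\<^sup>2 * ((cmod z)\<^sup>2 * (?R / (2 * \<kappa> * F)\<^sup>2 + ?I))"
    unfolding foot_tensor_def Let_def z_def[symmetric] L f2 by simp
  also have "\<dots> = 2 * F * (?R / (2 * \<kappa> * F)\<^sup>2 + ?I)" using z by simp
  also have "\<dots> = 2 * F / (2 * \<kappa> * F)\<^sup>2 * ?R + 2 * F * ?I" by (simp add: distrib_left)
  finally have "foot_tensor c b1 b2 i j w / b1\<^sup>2
      = 2 * F / (2 * \<kappa> * F)\<^sup>2 / b1\<^sup>2 * ?R + 2 * F / b1\<^sup>2 * ?I" by (simp add: add_divide_distrib)
  moreover have "2 * F / (2 * \<kappa> * F)\<^sup>2 / b1\<^sup>2 = 2 * B\<^sup>2 / ((a * b1)\<^sup>2 * G)"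
    using a B G b unfolding FG \<kappa>_def a_def[symmetric] B_def[symmetric]
    by (simp add: divide_simps) (simp add: power2_eq_square)
  moreover have "2 * F / b1\<^sup>2 = 2 * G / (a * b1)\<^sup>2"
    unfolding FG by (simp add: power_mult_distrib)
  ultimately have "foot_tensor c b1 b2 i j w / b1\<^sup>2
      = 2 * B\<^sup>2 / ((a * b1)\<^sup>2 * G) * ?R + 2 * G / (a * b1)\<^sup>2 * ?I" by (simp only:)
  then show ?thesis by (simp only: foot_limit_tensor_def Let_def G_def a_def B_def fst_conv snd_conv)
qed

end

section \<open>A differential algebra of tensor components\<close>

text \<open>Iterated partials depend only on the germ. This carries identities that hold only on an
  annulus over to all derivatives.\<close>

lemma dpart_cong:
  assumes "open V" "w \<in> V" "\<And>x. x \<in> V \<Longrightarrow> g x = g' x"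
  shows "dpart ds g w = dpart ds g' w"
  using assms(2)
proof (induction ds arbitrary: w)
  case (Cons d ds)
  have "((\<lambda>t. w + complex_of_real t * basis2 d) \<longlongrightarrow> w + complex_of_real 0 * basis2 d) (nhds 0)"
    by (intro tendsto_intros filterlim_ident)
  then have "eventually (\<lambda>t. w + complex_of_real t * basis2 d \<in> V) (nhds 0)"
    using topological_tendstoD[OF _ assms(1)] Cons.prems by simp
  then show ?case
    unfolding dpart.simps by (intro deriv_cong_ev) (auto elim!: eventually_mono intro: Cons.IH)
qed (use assms(3) in simp)

lemma dpart_zero: "dpart ds (\<lambda>_. 0) = (\<lambda>_. 0)"
  by (induction ds) auto

text \<open>No sign is imposed on \<open>snd p\<close>, so the limit 1 / a = 0 is an interior point
  of the parameters rather than a boundary case.\<close>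

definition foot_dom :: "real \<Rightarrow> ((real \<times> real) \<times> complex) set" where
  "foot_dom B = {(p, w). 0 < fst p \<and> w \<noteq> 0 \<and> 0 < mom (fst p) (fst p - 2 * B * snd p * ln (cmod w))}"

lemma open_foot_dom: "open (foot_dom B)"
proof -
  let ?g = "\<lambda>x :: (real \<times> real) \<times> complex.
    mom (fst (fst x)) (fst (fst x) - 2 * B * snd (fst x) * ln (cmod (snd x)))"
  let ?S = "{x :: (real \<times> real) \<times> complex. 0 < fst (fst x) \<and> snd x \<noteq> 0}"
  have "open ?S"
    by (intro open_Collect_conj open_Collect_less open_Collect_neq continuous_intros)
  moreover have "continuous_on ?S ?g"
    unfolding mom_def by (intro continuous_intros) auto
  ultimately have "open (?S \<inter> ?g -` {0<..})"
    by (intro continuous_open_preimage) auto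
  also have "?S \<inter> ?g -` {0<..} = foot_dom B" by (auto simp: foot_dom_def)
  finally show ?thesis .
qed

text \<open>The algebra is closed under both partial derivatives in \<open>w\<close> and its members are jointly continuous
  in \<open>(p, w)\<close>. Hence convergence of all derivatives, uniformly on compact sets, needs no estimates.\<close>
inductive foot_alg :: "real \<Rightarrow> (real \<times> real \<Rightarrow> complex \<Rightarrow> real) \<Rightarrow> bool" for B where
  foot_alg_param: "continuous_on {p. 0 < fst p} r \<Longrightarrow> foot_alg B (\<lambda>p w. r p)"
| foot_alg_Re: "foot_alg B (\<lambda>p w. Re w)"
| foot_alg_Im: "foot_alg B (\<lambda>p w. Im w)"
| foot_alg_inverse_norm: "foot_alg B (\<lambda>p w. 1 / (cmod w)\<^sup>2)"
| foot_alg_ln: "foot_alg B (\<lambda>p w. ln (cmod w))"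
| foot_alg_exp: "foot_alg B (\<lambda>p w. exp (fst p - 2 * B * snd p * ln (cmod w)))"
| foot_alg_inverse_mom: "foot_alg B (\<lambda>p w. inverse (mom (fst p) (fst p - 2 * B * snd p * ln (cmod w))))"
| foot_alg_add: "foot_alg B f \<Longrightarrow> foot_alg B g \<Longrightarrow> foot_alg B (\<lambda>p w. f p w + g p w)"
| foot_alg_mult: "foot_alg B f \<Longrightarrow> foot_alg B g \<Longrightarrow> foot_alg B (\<lambda>p w. f p w * g p w)"

lemma foot_alg_continuous:
  "foot_alg B h \<Longrightarrow> continuous_on (foot_dom B) (\<lambda>x. h (fst x) (snd x))"
proof (induction rule: foot_alg.induct)
  case (foot_alg_param r)
  then show ?case
    by (rule continuous_on_compose2) (auto intro!: continuous_intros simp: foot_dom_def)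
qed (auto intro!: continuous_intros simp: foot_dom_def mom_def)

lemma norm_line_deriv:
  "((\<lambda>t. (cmod (w + complex_of_real t * e))\<^sup>2) has_real_derivative 2 * (Re e * Re w + Im e * Im w)) (at 0)"
  unfolding cmod_power2 by (auto intro!: derivative_eq_intros)

lemma ln_norm_line_deriv:
  assumes "w \<noteq> 0"
  shows "((\<lambda>t. ln (cmod (w + complex_of_real t * e))) has_real_derivative
    (Re e * Re w + Im e * Im w) * (1 / (cmod w)\<^sup>2)) (at 0)"
proof -
  have l: "ln (cmod x) = ln ((cmod x)\<^sup>2) / 2" for x
    by (cases "x = 0") (auto simp: ln_realpow)
  have "((\<lambda>t. ln ((cmod (w + complex_of_real t * e))\<^sup>2)) has_real_derivative
      1 / (cmod (w + complex_of_real 0 * e))\<^sup>2 * (2 * (Re e * Re w + Im e * Im w))) (at 0)"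
    by (rule DERIV_chain2[OF DERIV_ln_divide norm_line_deriv]) (use assms in simp)
  then show ?thesis
    unfolding l by (rule DERIV_cong[OF DERIV_cdivide]) (use assms in \<open>simp add: field_simps\<close>)
qed

lemma foot_alg_deriv:
  "foot_alg B h \<Longrightarrow> \<exists>h'. foot_alg B h' \<and> (\<forall>p w. (p, w) \<in> foot_dom B \<longrightarrow>
     ((\<lambda>t. h p (w + complex_of_real t * basis2 d)) has_real_derivative h' p w) (at 0))"
proof (induction rule: foot_alg.induct)
  case (foot_alg_param r)
  have "foot_alg B (\<lambda>p w. 0)" by (rule foot_alg.foot_alg_param) simp
  then show ?case by (intro exI[of _ "\<lambda>p w. 0"]) auto
next
  case foot_alg_Re
  have "foot_alg B (\<lambda>p w. Re (basis2 d))" by (rule foot_alg_param) simp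
  then show ?case by (intro exI[of _ "\<lambda>p w. Re (basis2 d)"]) (auto intro!: derivative_eq_intros)
next
  case foot_alg_Im
  have "foot_alg B (\<lambda>p w. Im (basis2 d))" by (rule foot_alg_param) simp
  then show ?case by (intro exI[of _ "\<lambda>p w. Im (basis2 d)"]) (auto intro!: derivative_eq_intros)
next
  case foot_alg_inverse_norm
  let ?h = "\<lambda>(p :: real \<times> real) w. (- 2) * (Re (basis2 d) * Re w + Im (basis2 d) * Im w)
      * (1 / (cmod w)\<^sup>2 * (1 / (cmod w)\<^sup>2))"
  have "foot_alg B ?h"
    by (intro foot_alg.intros continuous_intros)
  moreover have "((\<lambda>t. 1 / (cmod (w + complex_of_real t * basis2 d))\<^sup>2) has_real_derivative ?h p w) (at 0)"
    if "w \<noteq> 0" for p :: "real \<times> real" and w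
  proof -
    have "((\<lambda>t. inverse ((cmod (w + complex_of_real t * basis2 d))\<^sup>2)) has_real_derivative ?h p w) (at 0)"
      by (rule DERIV_cong[OF DERIV_inverse'[OF norm_line_deriv]])
        (use that in \<open>simp_all add: inverse_eq_divide add_divide_distrib diff_divide_distrib\<close>)
    then show ?thesis by (simp add: inverse_eq_divide)
  qed
  ultimately show ?case by (intro exI[of _ ?h]) (auto simp: foot_dom_def)
next
  case foot_alg_ln
  let ?h = "\<lambda>(p :: real \<times> real) w. (Re (basis2 d) * Re w + Im (basis2 d) * Im w) * (1 / (cmod w)\<^sup>2)"
  have "foot_alg B ?h" by (intro foot_alg.intros continuous_intros)
  then show ?case using ln_norm_line_deriv
    by (intro exI[of _ ?h]) (auto simp: foot_dom_def)
next
  case foot_alg_exp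
  let ?l = "\<lambda>w. (Re (basis2 d) * Re w + Im (basis2 d) * Im w) * (1 / (cmod w)\<^sup>2)"
  let ?u = "\<lambda>(p :: real \<times> real) w. fst p - 2 * B * snd p * ln (cmod w)"
  let ?h = "\<lambda>p w. exp (?u p w) * ((- 2 * B * snd p) * ?l w)"
  have "foot_alg B ?h" by (intro foot_alg.intros continuous_intros)
  moreover have "((\<lambda>t. exp (?u p (w + complex_of_real t * basis2 d))) has_real_derivative ?h p w) (at 0)"
    if "w \<noteq> 0" for p w
    by (rule derivative_eq_intros ln_norm_line_deriv[OF that] refl)+ simp
  ultimately show ?case by (intro exI[of _ ?h]) (auto simp: foot_dom_def)
next
  case foot_alg_inverse_mom
  let ?l = "\<lambda>w. (Re (basis2 d) * Re w + Im (basis2 d) * Im w) * (1 / (cmod w)\<^sup>2)"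
  let ?u = "\<lambda>(p :: real \<times> real) w. fst p - 2 * B * snd p * ln (cmod w)"
  let ?i = "\<lambda>p w. inverse (mom (fst p) (?u p w))"
  let ?h = "\<lambda>p w. (- 1) * ((?i p w * ((1 + (- 1) * ((1 - fst p) * exp (?u p w))) * ((- 2 * B * snd p) * ?l w))) * ?i p w)"
  have "foot_alg B ?h" by (intro foot_alg.intros continuous_intros)
  moreover have "((\<lambda>t. ?i p (w + complex_of_real t * basis2 d)) has_real_derivative ?h p w) (at 0)"
    if "(p, w) \<in> foot_dom B" for p w
  proof -
    have w: "w \<noteq> 0" and G: "mom (fst p) (?u p w) \<noteq> 0" using that by (auto simp: foot_dom_def)
    have du: "((\<lambda>t. ?u p (w + complex_of_real t * basis2 d)) has_real_derivative (- 2 * B * snd p) * ?l w) (at 0)"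
      by (rule derivative_eq_intros ln_norm_line_deriv[OF w] refl)+ simp
    show ?thesis
      by (rule DERIV_cong[OF DERIV_inverse'[OF DERIV_chain2[OF mom_deriv du]]])
        (use G in simp_all)
  qed
  ultimately show ?case by (intro exI[of _ ?h]) auto
next
  case (foot_alg_add f g)
  then obtain f' g' where "foot_alg B f'" "foot_alg B g'"
    "\<forall>p w. (p, w) \<in> foot_dom B \<longrightarrow>
     ((\<lambda>t. f p (w + complex_of_real t * basis2 d)) has_real_derivative f' p w) (at 0)"
    "\<forall>p w. (p, w) \<in> foot_dom B \<longrightarrow>
     ((\<lambda>t. g p (w + complex_of_real t * basis2 d)) has_real_derivative g' p w) (at 0)"
    by blast
  then show ?case
    by (intro exI[of _ "\<lambda>p w. f' p w + g' p w"]) (auto intro!: foot_alg.intros DERIV_add)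
next
  case (foot_alg_mult f g)
  then obtain f' g' where *: "foot_alg B f'" "foot_alg B g'"
    "\<forall>p w. (p, w) \<in> foot_dom B \<longrightarrow>
     ((\<lambda>t. f p (w + complex_of_real t * basis2 d)) has_real_derivative f' p w) (at 0)"
    "\<forall>p w. (p, w) \<in> foot_dom B \<longrightarrow>
     ((\<lambda>t. g p (w + complex_of_real t * basis2 d)) has_real_derivative g' p w) (at 0)"
    by blast
  have "foot_alg B (\<lambda>p w. f' p w * g p w + g' p w * f p w)"
    by (intro foot_alg.intros * foot_alg_mult.hyps)
  moreover have "((\<lambda>t. f p (w + complex_of_real t * basis2 d) * g p (w + complex_of_real t * basis2 d))
      has_real_derivative f' p w * g p w + g' p w * f p w) (at 0)" if "(p, w) \<in> foot_dom B" for p w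
    using DERIV_mult[OF *(3)[rule_format, OF that] *(4)[rule_format, OF that]] by simp
  ultimately show ?case by blast
qed

lemma foot_alg_dpart:
  assumes "foot_alg B h"
  shows "\<exists>h'. foot_alg B h' \<and> (\<forall>p w. (p, w) \<in> foot_dom B \<longrightarrow> dpart ds (h p) w = h' p w)"
proof (induction ds)
  case Nil
  then show ?case using assms by auto
next
  case (Cons d ds)
  then obtain h1 where h1: "foot_alg B h1" "\<And>p w. (p, w) \<in> foot_dom B \<Longrightarrow> dpart ds (h p) w = h1 p w"
    by blast
  obtain h2 where h2: "foot_alg B h2" "\<And>p w. (p, w) \<in> foot_dom B \<Longrightarrow>
     ((\<lambda>t. h1 p (w + complex_of_real t * basis2 d)) has_real_derivative h2 p w) (at 0)"
    using foot_alg_deriv[OF h1(1)] by blast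
  have "dpart (d # ds) (h p) w = h2 p w" if "(p, w) \<in> foot_dom B" for p w
  proof -
    have "((\<lambda>t. (p, w + complex_of_real t * basis2 d)) \<longlongrightarrow> (p, w + complex_of_real 0 * basis2 d)) (nhds 0)"
      by (intro tendsto_intros filterlim_ident)
    then have "eventually (\<lambda>t. (p, w + complex_of_real t * basis2 d) \<in> foot_dom B) (nhds 0)"
      using topological_tendstoD[OF _ open_foot_dom] that by simp
    then have "dpart (d # ds) (h p) w = deriv (\<lambda>t. h1 p (w + complex_of_real t * basis2 d)) 0"
      unfolding dpart.simps by (intro deriv_cong_ev) (auto elim!: eventually_mono intro: h1(2))
    also have "\<dots> = h2 p w" by (rule DERIV_imp_deriv[OF h2(2)[OF that]])
    finally show ?thesis .
  qed
  then show ?case using h2(1) by blast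
qed

text \<open>The derivative extends to a jointly continuous function that vanishes on {p0} \<times>
  K. By the tube lemma the open set where it is small contains X \<times> K for a neighbourhood X of
  p0, which gives uniformity over K.\<close>

lemma foot_alg_dpart_small:
  assumes h: "foot_alg B h" and K: "compact K" "\<And>w. w \<in> K \<Longrightarrow> (p0, w) \<in> foot_dom B"
    and zero: "\<And>w. w \<noteq> 0 \<Longrightarrow> h p0 w = 0" and \<epsilon>: "\<epsilon> > 0"
  shows "eventually (\<lambda>p. \<forall>w\<in>K. \<bar>dpart ds (h p) w\<bar> < \<epsilon>) (nhds p0)"
proof -
  obtain h' where h': "foot_alg B h'" "\<And>p w. (p, w) \<in> foot_dom B \<Longrightarrow> dpart ds (h p) w = h' p w"
    using foot_alg_dpart[OF h] by blast
  define W where "W = foot_dom B \<inter> (\<lambda>x. h' (fst x) (snd x)) -` {-\<epsilon><..<\<epsilon>}"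
  have W: "open W"
    unfolding W_def
    by (rule continuous_open_preimage[OF foot_alg_continuous[OF h'(1)] open_foot_dom open_greaterThanLessThan])
  have sub: "{p0} \<times> K \<subseteq> W"
  proof
    fix x assume "x \<in> {p0} \<times> K"
    then obtain w where x: "x = (p0, w)" and w: "w \<in> K" by auto
    have "w \<noteq> 0" using K(2)[OF w] by (simp add: foot_dom_def)
    then have "dpart ds (h p0) w = dpart ds (\<lambda>_. 0) w"
      by (intro dpart_cong[of "- {0}"]) (simp_all add: zero open_Compl)
    then have "h' p0 w = 0" unfolding h'(2)[OF K(2)[OF w]] dpart_zero .
    then show "x \<in> W" using K(2)[OF w] \<epsilon> by (simp add: W_def x)
  qed
  obtain X where X: "p0 \<in> X" "open X" "X \<times> K \<subseteq> W"
    using Elementary_Topology.tube_lemma[OF K(1) W sub] by auto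
  have "\<bar>dpart ds (h p) w\<bar> < \<epsilon>" if pw: "p \<in> X" "w \<in> K" for p w
  proof -
    have "(p, w) \<in> W" using X pw by auto
    then show ?thesis using h'(2)[of p w] by (auto simp: W_def)
  qed
  with X(1,2) show ?thesis unfolding eventually_nhds by (intro exI[of _ X]) auto
qed

lemma foot_alg_limit_tensor: "foot_alg B (\<lambda>p w. foot_limit_tensor B i j p w - C * cyl_tensor i j w)"
proof -
  let ?R = "\<lambda>k w. (Re (basis2 k) * Re w + Im (basis2 k) * Im w) * (1 / (cmod w)\<^sup>2)"
  let ?I = "\<lambda>k w. (Im (basis2 k) * Re w + (- Re (basis2 k)) * Im w) * (1 / (cmod w)\<^sup>2)"
  let ?u = "\<lambda>(p :: real \<times> real) w. fst p + (- 2 * B * snd p) * ln (cmod w)"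
  let ?e = "\<lambda>(p :: real \<times> real) w. exp (fst p - 2 * B * snd p * ln (cmod w))"
  let ?h = "\<lambda>p w. 2 * B\<^sup>2 / (fst p)\<^sup>2 * inverse (mom (fst p) (fst p - 2 * B * snd p * ln (cmod w))) * (?R i w * ?R j w)
     + (2 / (fst p)\<^sup>2) * (?u p w + (1 - fst p) * (1 + (- 1) * ?e p w)) * (?I i w * ?I j w)
     + (if i = j then - C else 0) * (1 / (cmod w)\<^sup>2)"
  have R: "foot_alg B (\<lambda>p. ?R k)" and I: "foot_alg B (\<lambda>p. ?I k)" for k
    by (intro foot_alg.intros continuous_intros)+
  have G: "foot_alg B (\<lambda>p w. ?u p w + (1 - fst p) * (1 + (- 1) * ?e p w))"
    by (intro foot_alg.intros continuous_intros)
  have c: "foot_alg B (\<lambda>p w. r / (fst p)\<^sup>2)" and c': "foot_alg B (\<lambda>p w. r)" for r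
    by (rule foot_alg_param; auto intro!: continuous_intros)+
  have "foot_alg B ?h"
    by (rule foot_alg_add[OF foot_alg_add[OF
          foot_alg_mult[OF foot_alg_mult[OF c foot_alg_inverse_mom] foot_alg_mult[OF R R]]
          foot_alg_mult[OF foot_alg_mult[OF c G] foot_alg_mult[OF I I]]]
        foot_alg_mult[OF c' foot_alg_inverse_norm]])
  moreover have eq: "?h p w = foot_limit_tensor B i j p w - C * cyl_tensor i j w" for p w
  proof -
    define G where "G = mom (fst p) (fst p - 2 * B * snd p * ln (cmod w))"
    have R: "Re (basis2 k / w) = ?R k w" and I: "Im (basis2 k / w) = ?I k w" for k
      by (simp_all add: Re_divide Im_divide cmod_power2)
    have G: "?u p w + (1 - fst p) * (1 + (- 1) * ?e p w) = G" by (simp add: G_def mom_def)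
    have e1: "2 * B\<^sup>2 / ((fst p)\<^sup>2 * G) = 2 * B\<^sup>2 / (fst p)\<^sup>2 * inverse G"
      by (simp add: inverse_eq_divide)
    have e2: "2 * G / (fst p)\<^sup>2 = 2 / (fst p)\<^sup>2 * G" by simp
    have e3: "x - C * cyl_tensor i j w = x + (if i = j then - C else 0) * (1 / (cmod w)\<^sup>2)" for x
      by (simp add: cyl_tensor_def)
    show ?thesis
      unfolding foot_limit_tensor_def Let_def R I G G_def[symmetric] e1 e2 e3 by (rule refl)
  qed
  ultimately show ?thesis by (simp only: eq)
qed

section \<open>Convergence\<close>

text \<open>The origin of B: it is the limit profile at \<open>\<tau> = b1\<close>. The equation for
  b rewrites \<open>(1 - \<alpha>) e\<^sup>\<alpha>\<close> as
  \<open>(1 + b) e\<^sup>-\<^sup>b\<close>.\<close>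

lemma mom_b_par:
  assumes "0 < c" "c < 1"
  shows "mom (c * b_par c) (c * b_par c) = B_par c"
proof -
  have "(1 - c * b_par c) = (b_par c + 1) * exp (- b_par c * (c + 1))"
    using a_par_props(3)[OF assms] by (simp add: b_par_eq par_fun_def mult.commute)
  then have "(1 - c * b_par c) * exp (c * b_par c)
      = (b_par c + 1) * (exp (- b_par c * (c + 1)) * exp (c * b_par c))" by simp
  also have "exp (- b_par c * (c + 1)) * exp (c * b_par c) = exp (- b_par c)"
    by (simp add: algebra_simps flip: exp_add)
  finally have "(1 - c * b_par c) * exp (c * b_par c) = (b_par c + 1) * exp (- b_par c)" .
  then show ?thesis by (simp add: mom_def B_par_def algebra_simps)
qed

text \<open>Here the profile is the constant B, so the radial coefficient
  \<open>2 B\<^sup>2 / (\<alpha>\<^sup>2 B)\<close> and the angular one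
  \<open>2 B / \<alpha>\<^sup>2\<close> agree and the form becomes conformal.\<close>

lemma foot_limit_tensor_at_0:
  assumes "\<alpha> > 0" "B > 0" "mom \<alpha> \<alpha> = B" "w \<noteq> 0" "i < 2" "j < 2"
  shows "foot_limit_tensor B i j (\<alpha>, 0) w = 2 * B / \<alpha>\<^sup>2 * cyl_tensor i j w"
proof -
  have "2 * B\<^sup>2 / (\<alpha>\<^sup>2 * B) = 2 * B / \<alpha>\<^sup>2" using assms by (simp add: power2_eq_square)
  then have "foot_limit_tensor B i j (\<alpha>, 0) w
      = 2 * B / \<alpha>\<^sup>2 * inner (basis2 i / w) (basis2 j / w)"
    using assms(3) unfolding foot_limit_tensor_def inner_complex_def Let_def distrib_left by simp
  also have "inner (basis2 i / w) (basis2 j / w) = (cmod (1 / w))\<^sup>2 * inner (basis2 i) (basis2 j)"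
    using inner_complex_mult_left[of "1 / w" "basis2 i" "basis2 j"] by simp
  also have "\<dots> = cyl_tensor i j w"
    using assms(5,6) by (auto simp: cyl_tensor_def basis2_def norm_divide power_divide less_2_cases_iff)
  finally show ?thesis .
qed

theorem theorem1p3:
  fixes c :: real
  assumes "0 < c" and "c < 1"
  shows "\<exists>C > 0.
    (\<forall>K k \<epsilon>. compact K \<and> K \<subseteq> - {0} \<and> \<epsilon> > 0 \<longrightarrow>
       (\<exists>\<delta> > 0. \<forall>b1 b2. 0 < b1 \<and> b1 < b2 \<and> \<bar>b1 / b2 - c\<bar> < \<delta> \<and> b2 < \<delta> \<longrightarrow>
          K \<subseteq> Psi c b1 b2 ` (- {0}) \<and>
          (\<forall>ds i j. set ds \<subseteq> {0, 1} \<and> length ds \<le> k \<and> i < 2 \<and> j < 2 \<longrightarrow>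
             (\<forall>w\<in>K. \<bar>dpart ds (\<lambda>w. foot_tensor c b1 b2 i j w / b1\<^sup>2 - C * cyl_tensor i j w) w\<bar>
                      < \<epsilon>)))) \<and>
    (\<forall>b1 b2 x. 0 < b1 \<and> b1 < b2 \<and> 0 < x \<and> deriv (foot_pot b1 b2) (ln (x\<^sup>2)) = b1 \<longrightarrow>
       Psi c b1 b2 (complex_of_real x) = 1)"
proof -
  define B where "B = B_par c"
  define \<alpha> where "\<alpha> = c * b_par c"
  define C where "C = 2 * B / \<alpha>\<^sup>2"
  have bpos: "b_par c > 0" using a_par_props(1)[OF assms] by (simp add: b_par_eq)
  have \<alpha>: "\<alpha> > 0" using bpos assms by (simp add: \<alpha>_def)
  have B: "B > 0" "mom \<alpha> \<alpha> = B" using B_par_pos[OF assms] mom_b_par[OF assms] by (auto simp: B_def \<alpha>_def)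
  have C: "C > 0" using B \<alpha> by (simp add: C_def)
  \<comment> \<open>Scaling expresses (a b1, 1 / a) through (b1 / b2, b2) by a formula that is still
    continuous at b2 = 0.\<close>
  define p where "p x = (fst x * b_par (fst x), snd x / b_par (fst x))" for x :: "real \<times> real"
  have p0: "p (c, 0) = (\<alpha>, 0)" by (simp add: p_def \<alpha>_def)
  have "isCont p (c, 0)"
    unfolding p_def using isCont_b_par[OF assms] bpos
    by (intro continuous_intros isCont_o2[of _ fst b_par]) auto
  then have lim: "filterlim p (nhds (\<alpha>, 0)) (nhds (c, 0))"
    unfolding isCont_def p0[symmetric] tendsto_at_iff_tendsto_nhds .
  have p: "p (b1 / b2, b2) = (a_par b1 b2 * b1, 1 / a_par b1 b2)" if "0 < b1" "b1 < b2" for b1 b2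
    using that by (simp add: p_def a_par_scale)
  have conv: "\<exists>\<delta> > 0. \<forall>b1 b2. 0 < b1 \<and> b1 < b2 \<and> \<bar>b1 / b2 - c\<bar> < \<delta> \<and> b2 < \<delta> \<longrightarrow>
          K \<subseteq> Psi c b1 b2 ` (- {0}) \<and>
          (\<forall>ds i j. set ds \<subseteq> {0, 1} \<and> length ds \<le> k \<and> i < 2 \<and> j < 2 \<longrightarrow>
             (\<forall>w\<in>K. \<bar>dpart ds (\<lambda>w. foot_tensor c b1 b2 i j w / b1\<^sup>2 - C * cyl_tensor i j w) w\<bar>
                      < \<epsilon>))"
    if K: "compact K" "K \<subseteq> - {0}" and \<epsilon>: "\<epsilon> > 0" for K k \<epsilon>
  proof -
    let ?h = "\<lambda>i j p w. foot_limit_tensor B i j p w - C * cyl_tensor i j w"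
    have dom: "((\<alpha>, 0), w) \<in> foot_dom B" if "w \<in> K" for w
      using that K \<alpha> B by (auto simp: foot_dom_def)
    have ev: "eventually (\<lambda>p. \<forall>w\<in>K. \<bar>dpart ds (?h i j p) w\<bar> < \<epsilon>) (nhds (\<alpha>, 0))"
      if "i < 2" "j < 2" for i j ds
      by (rule foot_alg_dpart_small[OF foot_alg_limit_tensor K(1) dom _ \<epsilon>])
        (use foot_limit_tensor_at_0[OF \<alpha> B _ that] in \<open>simp_all add: C_def\<close>)
    have ev1: "eventually (\<lambda>p. \<forall>j\<in>{..<2}. \<forall>w\<in>K. \<bar>dpart ds (?h i j p) w\<bar> < \<epsilon>) (nhds (\<alpha>, 0))"
      if "i < 2" for i ds
      by (rule eventually_ball_finite[OF finite_lessThan]) (use ev that in auto)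
    have ev2: "eventually (\<lambda>p. \<forall>i\<in>{..<2}. \<forall>j\<in>{..<2}. \<forall>w\<in>K. \<bar>dpart ds (?h i j p) w\<bar> < \<epsilon>) (nhds (\<alpha>, 0))"
      for ds
      by (rule eventually_ball_finite[OF finite_lessThan]) (use ev1 in simp)
    have small: "eventually (\<lambda>p. \<forall>ds\<in>{ds. set ds \<subseteq> {0, 1} \<and> length ds \<le> k}. \<forall>i\<in>{..<2}. \<forall>j\<in>{..<2}.
        \<forall>w\<in>K. \<bar>dpart ds (?h i j p) w\<bar> < \<epsilon>) (nhds (\<alpha>, 0))"
      by (rule eventually_ball_finite[OF finite_lists_length_le]) (use ev2 in simp_all)
    have "compact ((\<lambda>w. ln (cmod w)) ` K)"
      by (rule compact_continuous_image[OF _ K(1)]) (use K(2) in \<open>auto intro!: continuous_intros\<close>)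
    then have "bounded ((\<lambda>w. ln (cmod w)) ` K)" by (rule compact_imp_bounded)
    then obtain M where "\<forall>y\<in>(\<lambda>w. ln (cmod w)) ` K. \<bar>y\<bar> \<le> M" unfolding bounded_real by blast
    then have M: "\<bar>ln (cmod w)\<bar> \<le> M" if "w \<in> K" for w using that by simp
    \<comment> \<open>At p = (a b1, 1 / a), positivity of this expression means
      \<open>M < \<kappa> b1\<close>. As b1 < b2, this puts K inside the annulus covered by
      \<open>Psi\<close>.\<close>
    have "((\<lambda>p. fst p - 2 * B * M * snd p) \<longlongrightarrow> fst (\<alpha>, 0::real) - 2 * B * M * snd (\<alpha>, 0::real)) (nhds (\<alpha>, 0))"
      by (intro tendsto_diff tendsto_mult_left tendsto_fst[OF filterlim_ident] tendsto_snd[OF filterlim_ident])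
    then have "eventually (\<lambda>p. 0 < fst p - 2 * B * M * snd p) (nhds (\<alpha>, 0))"
      by (rule order_tendstoD(1)) (use \<alpha> in simp)
    with small have "eventually (\<lambda>p. 0 < fst p - 2 * B * M * snd p \<and>
        (\<forall>ds\<in>{ds. set ds \<subseteq> {0, 1} \<and> length ds \<le> k}. \<forall>i\<in>{..<2}. \<forall>j\<in>{..<2}.
        \<forall>w\<in>K. \<bar>dpart ds (?h i j p) w\<bar> < \<epsilon>)) (nhds (\<alpha>, 0))"
      by eventually_elim simp
    from eventually_compose_filterlim[OF this lim]
    obtain r where r: "r > 0" "\<And>x. dist x (c, 0) < r \<Longrightarrow> 0 < fst (p x) - 2 * B * M * snd (p x) \<and>
        (\<forall>ds\<in>{ds. set ds \<subseteq> {0, 1} \<and> length ds \<le> k}. \<forall>i\<in>{..<2}. \<forall>j\<in>{..<2}.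
        \<forall>w\<in>K. \<bar>dpart ds (?h i j (p x)) w\<bar> < \<epsilon>)"
      unfolding eventually_nhds_metric by blast
    show ?thesis
    proof (intro exI[of _ "r / 2"] conjI allI impI; (elim conjE)?)
      show "0 < r / 2" using r by simp
    next
      fix b1 b2 :: real
      assume b: "0 < b1" "b1 < b2" and d: "\<bar>b1 / b2 - c\<bar> < r / 2" "b2 < r / 2"
      define a where "a = a_par b1 b2"
      have a: "a > 0" using a_par_props(1)[OF b] by (simp add: a_def)
      define \<kappa> where "\<kappa> = a\<^sup>2 / (2 * B)"
      have \<kappa>: "\<kappa> > 0" using a B by (simp add: \<kappa>_def)
      have "dist (b1 / b2, b2) (c, 0) \<le> \<bar>b1 / b2 - c\<bar> + \<bar>b2\<bar>"
        using sqrt_sum_squares_le_sum_abs[of "b1 / b2 - c" b2] by (simp add: dist_Pair_Pair dist_real_def)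
      then have "dist (b1 / b2, b2) (c, 0) < r" using d b by simp
      note r' = r(2)[OF this, unfolded p[OF b], folded a_def]
      have "M < \<kappa> * b1"
        using r' a B by (simp add: \<kappa>_def field_simps power2_eq_square)
      moreover have "\<kappa> * b1 < \<kappa> * b2" using b \<kappa> by simp
      ultimately have ann: "w \<noteq> 0 \<and> - (\<kappa> * b2) < ln (cmod w) \<and> ln (cmod w) < \<kappa> * b1" if "w \<in> K" for w
        using M[OF that] K(2) that by auto
      show "K \<subseteq> Psi c b1 b2 ` (- {0})"
        using in_Psi_image[OF b assms] ann by (auto simp: \<kappa>_def a_def B_def)
      fix ds :: "nat list" and i j :: nat
      assume ds: "set ds \<subseteq> {0, 1}" "length ds \<le> k" and ij: "i < 2" "j < 2"
      show "\<forall>w\<in>K. \<bar>dpart ds (\<lambda>w. foot_tensor c b1 b2 i j w / b1\<^sup>2 - C * cyl_tensor i j w) w\<bar> < \<epsilon>"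
      proof
        fix w assume w: "w \<in> K"
        \<comment> \<open>The annulus is written with exponentials to make its openness immediate
          and to exclude 0, where HOL sets ln 0 = 0.\<close>
        define V where "V = {w. exp (- (\<kappa> * b2)) < cmod w \<and> cmod w < exp (\<kappa> * b1)}"
        have V: "w \<in> V \<longleftrightarrow> w \<noteq> 0 \<and> - (\<kappa> * b2) < ln (cmod w) \<and> ln (cmod w) < \<kappa> * b1" for w
        proof (cases "w = 0")
          case True
          then show ?thesis by (simp add: V_def not_less less_imp_le)
        next
          case False
          then have "cmod w = exp (ln (cmod w))" by simp
          then show ?thesis unfolding V_def mem_Collect_eq by (metis False exp_less_cancel_iff)
        qed
        have "open V" unfolding V_def
          by (intro open_Collect_conj open_Collect_less continuous_intros)
        then have "dpart ds (\<lambda>w. foot_tensor c b1 b2 i j w / b1\<^sup>2 - C * cyl_tensor i j w) w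
            = dpart ds (?h i j (a * b1, 1 / a)) w"
          by (rule dpart_cong)
            (use V ann[OF w] foot_tensor_eq[OF b assms] in \<open>auto simp: \<kappa>_def a_def B_def\<close>)
        then show "\<bar>dpart ds (\<lambda>w. foot_tensor c b1 b2 i j w / b1\<^sup>2 - C * cyl_tensor i j w) w\<bar> < \<epsilon>"
          using r' ds ij w by simp
      qed
    qed
  qed
  show ?thesis
    using C conv by (intro exI[of _ C]) (auto simp: Psi_def)
qed

end
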